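(* Let $p$ be a prime, $X$ a countable set, and let $A\in\mathcal{B}(\mathbb{Q}_p(X))$ be a normal contraction. Then there is a contractive homomorphism of $\mathbb{Z}_p$-algebras $\pi_A: C(\mathbb{Z}_p,\mathbb{Z}_p)\to\mathcal{B}(\mathbb{Q}_p(X))$ with $\pi_A(\mathrm{id}_{\mathbb{Z}_p})=A$, where $C(\mathbb{Z}_p,\mathbb{Z}_p)$ carries the supremum norm.
   Context: $\mathbb{Q}_p(X)$ is the set of maps $\xi:X\to\mathbb{Q}_p$ with $|\xi(i)|_p\le1$ for all but finitely many $i$, a $\mathbb{Z}_p$-module under coordinatewise operations, with the topology $\tau$ in which $A\subseteq\mathbb{Q}_p(X)$ is open iff for every finite $P\subseteq X$ the set $A\cap\big(\prod_{i\in P}\mathbb{Q}_p\times\prod_{j\in X\setminus P}\mathbb{Z}_p\big)$ is open in the product topology. $\mathcal{B}(\mathbb{Q}_p(X))$ is the $\mathbb{Z}_p$-algebra of $\tau$-continuous $\mathbb{Z}_p$-linear maps on $\mathbb{Q}_p(X)$ with operator norm $\|T\|=\sup_{\|\xi\|\le1}\|T\xi\|$, $\|\xi\|=\max_i|\xi(i)|_p$. An operator $A\in\mathcal{B}(\mathbb{Q}_p(X))$ is a normal contraction if for every $n\in\mathbb{N}$ the quotient $\binom{A}{n}:=\frac{A(A-1)\cdots(A-(n-1))}{n!}$ is defined as an element of $\mathcal{B}(\mathbb{Q}_p(X))$ (i.e. there is an operator $B$ in $\mathcal{B}(\mathbb{Q}_p(X))$ with $n!\,B=A(A-1)\cdots(A-(n-1))$)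 and satisfies $\|\binom{A}{n}\|\le1$. $C(\mathbb{Z}_p,\mathbb{Z}_p)$ is the $\mathbb{Z}_p$-algebra of continuous functions $\mathbb{Z}_p\to\mathbb{Z}_p$; contractive means $\|\pi_A(f)\|\le\|f\|_{\sup}$. *)

theory Defs
  imports "HOL-Library.Countable_Set" "HOL-Library.FuncSet" "HOL-Computational_Algebra.Primes" Complex_Main
begin

text \<open>
  An element x of Q_p is represented canonically by the coherent sequence of its
  residues modulo p^n Z_p:  x n is the unique rational of the form a/p^k with
  0 \<le> x n < p^n and x n \<equiv> x (mod p^n Z_p).  (Q_p = lim Q_p/p^n Z_p and
  Q_p/p^n Z_p = Z[1/p]/p^n Z.)  Equality of p-adic numbers is equality of these
  sequences, so no quotient is needed.
\<close>

type_synonym qp = "nat \<Rightarrow> rat"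

definition rmod :: "nat \<Rightarrow> nat \<Rightarrow> rat \<Rightarrow> rat" where
  "rmod p n q = q - of_nat p ^ n * of_int \<lfloor>q / of_nat p ^ n\<rfloor>"

definition Qp :: "nat \<Rightarrow> qp set" where
  "Qp p = {x. \<forall>n. (\<exists>a k. x n = of_int a / of_nat p ^ k) \<and> 0 \<le> x n \<and>
                   x n < of_nat p ^ n \<and> x n = rmod p n (x (Suc n))}"

text \<open>The p-adic integers: the elements whose residue modulo Z_p vanishes.\<close>
definition Zp :: "nat \<Rightarrow> qp set" where
  "Zp p = {x \<in> Qp p. x 0 = 0}"

definition qzero :: qp where "qzero = (\<lambda>n. 0)"

definition qint :: "nat \<Rightarrow> int \<Rightarrow> qp" where
  "qint p a = (\<lambda>n. rmod p n (of_int a))"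

definition qone :: "nat \<Rightarrow> qp" where "qone p = qint p 1"

definition qadd :: "nat \<Rightarrow> qp \<Rightarrow> qp \<Rightarrow> qp" where
  "qadd p x y = (\<lambda>n. rmod p n (x n + y n))"

definition qneg :: "nat \<Rightarrow> qp \<Rightarrow> qp" where
  "qneg p x = (\<lambda>n. rmod p n (- x n))"

definition qsub :: "nat \<Rightarrow> qp \<Rightarrow> qp \<Rightarrow> qp" where
  "qsub p x y = qadd p x (qneg p y)"

text \<open>Exponent of the denominator: least k with p^k x \<in> Z_p.\<close>
definition qden :: "nat \<Rightarrow> qp \<Rightarrow> nat" where
  "qden p x = (LEAST k. \<exists>a. x 0 * of_nat p ^ k = of_int a)"

text \<open>Multiplication: the residue of x*y mod p^n is determined by residues of
  x, y modulo p^(n + qden x + qden y).\<close>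
definition qmul :: "nat \<Rightarrow> qp \<Rightarrow> qp \<Rightarrow> qp" where
  "qmul p x y = (\<lambda>n. let m = n + qden p x + qden p y in rmod p n (x m * y m))"

definition qnorm :: "nat \<Rightarrow> qp \<Rightarrow> real" where
  "qnorm p x = (if x = qzero then 0
               else if x 0 \<noteq> 0 then real p ^ qden p x
               else inverse (real p ^ ((LEAST n. x n \<noteq> 0) - 1)))"

type_synonym 'a qvec = "'a \<Rightarrow> qp"

definition QpX :: "nat \<Rightarrow> 'a set \<Rightarrow> 'a qvec set" where
  "QpX p X = {\<xi> \<in> X \<rightarrow>\<^sub>E Qp p. finite {i \<in> X. \<xi> i \<notin> Zp p}}"

definition vadd :: "nat \<Rightarrow> 'a set \<Rightarrow> 'a qvec \<Rightarrow> 'a qvec \<Rightarrow> 'a qvec" where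
  "vadd p X \<xi> \<eta> = restrict (\<lambda>i. qadd p (\<xi> i) (\<eta> i)) X"

definition vsub :: "nat \<Rightarrow> 'a set \<Rightarrow> 'a qvec \<Rightarrow> 'a qvec \<Rightarrow> 'a qvec" where
  "vsub p X \<xi> \<eta> = restrict (\<lambda>i. qsub p (\<xi> i) (\<eta> i)) X"

definition vscal :: "nat \<Rightarrow> 'a set \<Rightarrow> qp \<Rightarrow> 'a qvec \<Rightarrow> 'a qvec" where
  "vscal p X c \<xi> = restrict (\<lambda>i. qmul p c (\<xi> i)) X"

text \<open>norm of xi = max_i |\<xi>(i)|_p (the 0 only matters for X empty).\<close>
definition vnorm :: "nat \<Rightarrow> 'a set \<Rightarrow> 'a qvec \<Rightarrow> real" where
  "vnorm p X \<xi> = Sup (insert 0 ((\<lambda>i. qnorm p (\<xi> i)) ` X))"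

definition boxP :: "nat \<Rightarrow> 'a set \<Rightarrow> 'a set \<Rightarrow> 'a qvec set" where
  "boxP p X P = {\<xi> \<in> X \<rightarrow>\<^sub>E Qp p. \<forall>j \<in> X - P. \<xi> j \<in> Zp p}"

text \<open>Openness of a subset B of boxP p X P in the product topology of
  \<Prod>_{i\<in>P} Q_p \<times> \<Prod>_{j\<in>X-P} Z_p (each factor with its p-adic metric topology),
  written out via basic open sets: finitely many coordinates constrained to balls.\<close>
definition prod_open :: "nat \<Rightarrow> 'a set \<Rightarrow> 'a set \<Rightarrow> 'a qvec set \<Rightarrow> bool" where
  "prod_open p X P B \<longleftrightarrow> B \<subseteq> boxP p X P \<and>
     (\<forall>\<xi> \<in> B. \<exists>F \<epsilon>. finite F \<and> F \<subseteq> X \<and> \<epsilon> > 0 \<and>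
        (\<forall>\<eta> \<in> boxP p X P. (\<forall>i \<in> F. qnorm p (qsub p (\<eta> i) (\<xi> i)) < \<epsilon>) \<longrightarrow> \<eta> \<in> B))"

definition tau_open :: "nat \<Rightarrow> 'a set \<Rightarrow> 'a qvec set \<Rightarrow> bool" where
  "tau_open p X A \<longleftrightarrow> A \<subseteq> QpX p X \<and>
     (\<forall>P. finite P \<and> P \<subseteq> X \<longrightarrow> prod_open p X P (A \<inter> boxP p X P))"

definition tau_continuous :: "nat \<Rightarrow> 'a set \<Rightarrow> ('a qvec \<Rightarrow> 'a qvec) \<Rightarrow> bool" where
  "tau_continuous p X T \<longleftrightarrow>
     (\<forall>A. tau_open p X A \<longrightarrow> tau_open p X {\<xi> \<in> QpX p X. T \<xi> \<in> A})"

definition Zp_linear :: "nat \<Rightarrow> 'a set \<Rightarrow> ('a qvec \<Rightarrow> 'a qvec) \<Rightarrow> bool" where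
  "Zp_linear p X T \<longleftrightarrow>
     (\<forall>\<xi> \<in> QpX p X. T \<xi> \<in> QpX p X) \<and>
     (\<forall>\<xi> \<in> QpX p X. \<forall>\<eta> \<in> QpX p X. T (vadd p X \<xi> \<eta>) = vadd p X (T \<xi>) (T \<eta>)) \<and>
     (\<forall>c \<in> Zp p. \<forall>\<xi> \<in> QpX p X. T (vscal p X c \<xi>) = vscal p X c (T \<xi>))"

text \<open>\<B>(Q_p(X)); operators are only meaningful on Q_p(X).\<close>
definition Bops :: "nat \<Rightarrow> 'a set \<Rightarrow> ('a qvec \<Rightarrow> 'a qvec) set" where
  "Bops p X = {T. Zp_linear p X T \<and> tau_continuous p X T}"

definition opnorm :: "nat \<Rightarrow> 'a set \<Rightarrow> ('a qvec \<Rightarrow> 'a qvec) \<Rightarrow> real" where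
  "opnorm p X T = Sup (insert 0 {vnorm p X (T \<xi>) | \<xi>. \<xi> \<in> QpX p X \<and> vnorm p X \<xi> \<le> 1})"

primrec falling_op :: "nat \<Rightarrow> 'a set \<Rightarrow> ('a qvec \<Rightarrow> 'a qvec) \<Rightarrow> nat \<Rightarrow> ('a qvec \<Rightarrow> 'a qvec)" where
  "falling_op p X A 0 = (\<lambda>\<xi>. \<xi>)"
| "falling_op p X A (Suc n) =
     (\<lambda>\<xi>. vsub p X (A (falling_op p X A n \<xi>)) (vscal p X (qint p (int n)) (falling_op p X A n \<xi>)))"

definition normal_contraction :: "nat \<Rightarrow> 'a set \<Rightarrow> ('a qvec \<Rightarrow> 'a qvec) \<Rightarrow> bool" where
  "normal_contraction p X A \<longleftrightarrow>
     (\<forall>n. \<exists>B \<in> Bops p X.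
        (\<forall>\<xi> \<in> QpX p X. vscal p X (qint p (int (fact n))) (B \<xi>) = falling_op p X A n \<xi>) \<and>
        opnorm p X B \<le> 1)"

definition Zp_continuous :: "nat \<Rightarrow> (qp \<Rightarrow> qp) \<Rightarrow> bool" where
  "Zp_continuous p f \<longleftrightarrow> (\<forall>z \<in> Zp p. \<forall>\<epsilon>>0. \<exists>\<delta>>0. \<forall>w \<in> Zp p.
      qnorm p (qsub p w z) < \<delta> \<longrightarrow> qnorm p (qsub p (f w) (f z)) < \<epsilon>)"

definition CZ :: "nat \<Rightarrow> (qp \<Rightarrow> qp) set" where
  "CZ p = {f \<in> Zp p \<rightarrow>\<^sub>E Zp p. Zp_continuous p f}"

definition cadd :: "nat \<Rightarrow> (qp \<Rightarrow> qp) \<Rightarrow> (qp \<Rightarrow> qp) \<Rightarrow> (qp \<Rightarrow> qp)" where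
  "cadd p f g = restrict (\<lambda>z. qadd p (f z) (g z)) (Zp p)"

definition cmul :: "nat \<Rightarrow> (qp \<Rightarrow> qp) \<Rightarrow> (qp \<Rightarrow> qp) \<Rightarrow> (qp \<Rightarrow> qp)" where
  "cmul p f g = restrict (\<lambda>z. qmul p (f z) (g z)) (Zp p)"

definition cscal :: "nat \<Rightarrow> qp \<Rightarrow> (qp \<Rightarrow> qp) \<Rightarrow> (qp \<Rightarrow> qp)" where
  "cscal p c f = restrict (\<lambda>z. qmul p c (f z)) (Zp p)"

definition cone :: "nat \<Rightarrow> (qp \<Rightarrow> qp)" where
  "cone p = restrict (\<lambda>z. qone p) (Zp p)"

definition cid :: "nat \<Rightarrow> (qp \<Rightarrow> qp)" where
  "cid p = restrict (\<lambda>z. z) (Zp p)"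

definition supnorm :: "nat \<Rightarrow> (qp \<Rightarrow> qp) \<Rightarrow> real" where
  "supnorm p f = Sup ((\<lambda>z. qnorm p (f z)) ` Zp p)"

end

theory Submission
  imports Defs
begin

text \<open>
  Write \<open>B n\<close> for the operator binomial coefficients of \<open>A\<close>. A continuous \<open>f\<close> has a Mahler expansion
  whose coefficients \<open>c n\<close>, the iterated differences of \<open>f\<close> at 0, tend to 0, and \<open>\<pi> f\<close> is the sum of the
  \<open>c n B n\<close>. Both sides are read modulo powers of p: there \<open>f\<close> is a periodic integer sequence and
  the sum is finite. Multiplicativity is only needed for finite sums; since \<open>A B n = n B n + (n + 1) B (n + 1)\<close>,
  the map from integer-valued polynomials to operators turns multiplication by x into composition with \<open>A\<close>,
  hence multiplication by \<open>n!\<close> times the n-th binomial polynomial into \<open>n! B n\<close>, and \<open>n!\<close> cancels because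
  the module is torsion-free. Contractivity holds because differences of \<open>f\<close> are bounded by \<open>f\<close>.
  An additive map is \<open>\<tau>\<close>-continuous iff it is continuous at 0 on the unit ball, where the sum
  converges uniformly.
\<close>

section \<open>Residue sequences of p-adic numbers\<close>

text \<open>No single truncation of the series serves all vectors, because denominators in Q_p(X)
  are unbounded. If p^d \<xi> is integral, the residue modulo p^m of the sum at \<xi> requires the
  coefficients modulo p^(m + d), so the precision J >= m + d is adapted to the vector. A function
  enters only through its values at the natural numbers, which are dense in Z_p, and any integer
  sequence congruent to these values modulo p^J may stand for it. This freedom reduces products to
  polynomials: two functions are replaced by truncated Newton series, whose product stands for the
  product function and has finitely many nonzero coefficients. The period p^N of such a sequence
  modulo p^J comes from compactness of Z_p. Homogeneity over Z_p follows from multiplicativity,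
  since a scalar acts as a constant function. Congruence is taken modulo p^n Z inside the rationals;
  on Z[1/p] this is congruence modulo p^n Z_p, because Z[1/p] meets Z_p in Z.\<close>

definition pcong :: "nat \<Rightarrow> nat \<Rightarrow> rat \<Rightarrow> rat \<Rightarrow> bool" where
  "pcong p n a b \<longleftrightarrow> (\<exists>t::int. a - b = of_nat p ^ n * of_int t)"

lemma pcong_refl [simp]: "pcong p n a a"
  unfolding pcong_def by (rule exI[of _ 0]) simp

lemma pcong_sym: "pcong p n a b \<Longrightarrow> pcong p n b a"
proof -
  assume "pcong p n a b"
  then obtain t where "a - b = of_nat p ^ n * of_int t" unfolding pcong_def by blast
  then have "b - a = of_nat p ^ n * of_int (- t)" by (simp add: algebra_simps)
  then show ?thesis unfolding pcong_def by blast
qed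

lemma pcong_add:
  assumes "pcong p n a b" "pcong p n c d"
  shows "pcong p n (a + c) (b + d)"
proof -
  obtain t u where "a - b = of_nat p ^ n * of_int t" "c - d = of_nat p ^ n * of_int u"
    using assms unfolding pcong_def by blast
  then have "(a + c) - (b + d) = of_nat p ^ n * of_int (t + u)" by (simp add: algebra_simps)
  then show ?thesis unfolding pcong_def by blast
qed

lemma pcong_trans [trans]: "pcong p n a b \<Longrightarrow> pcong p n b c \<Longrightarrow> pcong p n a c"
  using pcong_add[of p n a b b c] by (simp add: pcong_def)

lemma pcong_mult:
  assumes "pcong p n a b"
  shows "pcong p n (of_int c * a) (of_int c * b)"
proof -
  obtain t where "a - b = of_nat p ^ n * of_int t" using assms unfolding pcong_def by blast
  then have "of_int c * a - of_int c * b = of_nat p ^ n * of_int (c * t)"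
    by (simp add: right_diff_distrib[symmetric])
  then show ?thesis unfolding pcong_def by blast
qed

lemma pcong_minus: "pcong p n a b \<Longrightarrow> pcong p n (- a) (- b)"
  using pcong_mult[of p n a b "-1"] by simp

lemma pcong_diff: "pcong p n a b \<Longrightarrow> pcong p n c d \<Longrightarrow> pcong p n (a - c) (b - d)"
  using pcong_add[of p n a b "-c" "-d"] by (simp add: pcong_minus)

lemma pcong_sum: "(\<And>i. i \<in> S \<Longrightarrow> pcong p n (f i) (g i)) \<Longrightarrow> pcong p n (sum f S) (sum g S)"
  by (induction S rule: infinite_finite_induct) (auto intro: pcong_add)

lemma pcong_mono: "pcong p n a b \<Longrightarrow> m \<le> n \<Longrightarrow> pcong p m a b"
proof -
  assume "pcong p n a b" "m \<le> n"
  then obtain t where "a - b = of_nat p ^ n * of_int t" unfolding pcong_def by auto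
  then have "a - b = of_nat p ^ m * of_int (int p ^ (n - m) * t)"
    using \<open>m \<le> n\<close> by (simp add: power_add[symmetric] mult.assoc[symmetric])
  then show ?thesis unfolding pcong_def by blast
qed

lemma pcong_diff_0: "pcong p n (a - b) 0 \<longleftrightarrow> pcong p n a b"
  unfolding pcong_def by simp

text \<open>Source of the conditions \<open>m + d <= J\<close> below: a factor with denominator p^d
  consumes d of the J available powers of p.\<close>

lemma pcong_dvd: "int p ^ J dvd c \<Longrightarrow> m + d \<le> J \<Longrightarrow> a * of_nat p ^ d = of_int t
    \<Longrightarrow> pcong p m (of_int c * a) 0"
proof -
  assume "int p ^ J dvd c" "m + d \<le> J" and a: "a * of_nat p ^ d = of_int t"
  then obtain e where e: "c = int p ^ (m + d) * e"
    by (meson dvdE dvd_trans le_imp_power_dvd)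
  have "of_int c * a - 0 = of_nat p ^ m * of_int (e * t)"
    by (simp add: e power_add a[symmetric])
  then show ?thesis unfolding pcong_def by blast
qed

lemma pcong_int_dvd: "pcong p n (of_int a) (of_int b) \<longleftrightarrow> int p ^ n dvd a - b"
proof -
  have "pcong p n (of_int a) (of_int b) \<longleftrightarrow> (\<exists>t. (of_int (a - b) :: rat) = of_int (int p ^ n * t))"
    unfolding pcong_def by simp
  also have "\<dots> \<longleftrightarrow> int p ^ n dvd a - b"
    unfolding of_int_eq_iff dvd_def ..
  finally show ?thesis .
qed

definition plike :: "nat \<Rightarrow> rat \<Rightarrow> bool" where
  "plike p a \<longleftrightarrow> (\<exists>b k. a = of_int b / of_nat p ^ k)"

locale prime_base =
  fixes p :: nat
  assumes prime_p: "prime p"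
begin

lemma p_gt_0 [simp]: "p > 0" and p_gt_1: "p > 1" and p_neq_0 [simp]: "p \<noteq> 0"
  using prime_gt_1_nat[OF prime_p] by auto

lemma pcong_rmod [simp]: "pcong p n (rmod p n a) a"
  unfolding pcong_def rmod_def
  by (rule exI[of _ "- \<lfloor>a / of_nat p ^ n\<rfloor>"]) simp

lemma rmod_bounds: "0 \<le> rmod p n a" "rmod p n a < of_nat p ^ n"
proof -
  let ?q = "(of_nat p :: rat) ^ n"
  have q: "?q > 0" by simp
  have "of_int \<lfloor>a / ?q\<rfloor> * ?q \<le> a"
    unfolding pos_le_divide_eq[OF q, symmetric] by (rule of_int_floor_le)
  moreover have "a < (of_int \<lfloor>a / ?q\<rfloor> + 1) * ?q"
    unfolding pos_divide_less_eq[OF q, symmetric] by linarith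
  ultimately show "0 \<le> rmod p n a" "rmod p n a < ?q"
    unfolding rmod_def by (simp_all add: algebra_simps)
qed

lemma pcong_unique:
  assumes "pcong p n a b" "0 \<le> a" "a < of_nat p ^ n" "0 \<le> b" "b < of_nat p ^ n"
  shows "a = b"
proof -
  let ?q = "(of_nat p :: rat) ^ n"
  have q: "?q > 0" by simp
  obtain t where t: "a - b = ?q * of_int t" using assms(1) unfolding pcong_def by auto
  have "?q * of_int t < ?q * 1" "?q * of_int (-1) < ?q * of_int t"
    using t[symmetric] assms(2-) by auto
  then have "of_int t < (1::rat)" "of_int (-1) < (of_int t :: rat)"
    unfolding mult_less_cancel_left_pos[OF q] .
  then have "t = 0" unfolding of_int_less_iff by linarith
  with t show ?thesis by simp
qed

lemma rmod_eq_iff: "rmod p n a = rmod p n b \<longleftrightarrow> pcong p n a b"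
proof
  assume "rmod p n a = rmod p n b"
  then show "pcong p n a b" by (metis pcong_rmod pcong_sym pcong_trans)
next
  assume "pcong p n a b"
  then have "pcong p n (rmod p n a) (rmod p n b)" by (meson pcong_rmod pcong_sym pcong_trans)
  then show "rmod p n a = rmod p n b" using pcong_unique rmod_bounds by blast
qed

lemma rmod_eqI: "pcong p n a b \<Longrightarrow> rmod p n a = rmod p n b"
  by (simp add: rmod_eq_iff)

lemma rmod_0 [simp]: "rmod p n 0 = 0"
  by (simp add: rmod_def)

lemma rmod_eq_0: "rmod p n a = 0 \<longleftrightarrow> pcong p n a 0"
  using rmod_eq_iff[of n a 0] by simp

lemma rmod_id: "0 \<le> a \<Longrightarrow> a < of_nat p ^ n \<Longrightarrow> rmod p n a = a"
  by (rule pcong_unique[OF pcong_rmod]) (auto simp: rmod_bounds)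

lemma plike_int [simp]: "plike p (of_int a)"
  unfolding plike_def by (rule exI[of _ a], rule exI[of _ 0]) simp

lemma plike_mult_int: "plike p a \<Longrightarrow> plike p (of_int c * a)"
proof -
  assume "plike p a"
  then obtain b k where "a = of_int b / of_nat p ^ k" unfolding plike_def by blast
  then have "of_int c * a = of_int (c * b) / of_nat p ^ k" by simp
  then show ?thesis unfolding plike_def by blast
qed

lemma plike_minus: "plike p a \<Longrightarrow> plike p (- a)"
  using plike_mult_int[of a "-1"] by simp

lemma plike_divp: "plike p a \<Longrightarrow> plike p (a / of_nat p ^ k)"
proof -
  assume "plike p a"
  then obtain b l where "a = of_int b / of_nat p ^ l" unfolding plike_def by blast
  then have "a / of_nat p ^ k = of_int b / of_nat p ^ (l + k)" by (simp add: power_add)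
  then show ?thesis unfolding plike_def by blast
qed

lemma plike_add: "plike p a \<Longrightarrow> plike p b \<Longrightarrow> plike p (a + b)"
proof -
  assume "plike p a" "plike p b"
  then obtain a' k b' l where "a = of_int a' / of_nat p ^ k" "b = of_int b' / of_nat p ^ l"
    unfolding plike_def by auto
  moreover have "(of_nat p :: rat) ^ k \<noteq> 0" "(of_nat p :: rat) ^ l \<noteq> 0" by simp_all
  ultimately have "a + b = of_int (a' * int p ^ l + b' * int p ^ k) / of_nat p ^ (k + l)"
    by (simp add: power_add add_frac_eq)
  then show ?thesis unfolding plike_def by blast
qed

lemma plike_sum: "(\<And>i. i \<in> S \<Longrightarrow> plike p (f i)) \<Longrightarrow> plike p (sum f S)"
proof (induction S rule: infinite_finite_induct)
  case (insert x F)
  then show ?case by (auto intro: plike_add)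
qed (use plike_int[of 0] in simp_all)

lemma plike_rmod: "plike p a \<Longrightarrow> plike p (rmod p n a)"
proof -
  assume a: "plike p a"
  have "rmod p n a = a + of_int (- (int p ^ n * \<lfloor>a / of_nat p ^ n\<rfloor>))"
    by (simp add: rmod_def)
  then show ?thesis using a plike_add plike_int by metis
qed

section \<open>Coherent residue sequences and their arithmetic\<close>

lemma Qp_iff: "x \<in> Qp p \<longleftrightarrow> (\<forall>n. plike p (x n) \<and> 0 \<le> x n \<and> x n < of_nat p ^ n \<and> x n = rmod p n (x (Suc n)))"
  unfolding Qp_def plike_def mem_Collect_eq ..

lemma Qp_step: "x \<in> Qp p \<Longrightarrow> x n = rmod p n (x (Suc n))"
  unfolding Qp_iff by blast

lemma Qp_bounds: "x \<in> Qp p \<Longrightarrow> 0 \<le> x n" "x \<in> Qp p \<Longrightarrow> x n < of_nat p ^ n"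
  unfolding Qp_iff by blast+

text \<open>The general way to build a p-adic number: representatives in Z[1/p] need only be
  congruent from one level to the next, and \<open>rmod\<close> normalizes them.\<close>

lemma Qp_rmodI:
  assumes "\<And>n. plike p (y n)" "\<And>n. pcong p n (y n) (y (Suc n))"
  shows "(\<lambda>n. rmod p n (y n)) \<in> Qp p"
  unfolding Qp_iff
proof (intro allI conjI)
  fix n
  show "plike p (rmod p n (y n))" using assms(1) plike_rmod by blast
  show "0 \<le> rmod p n (y n)" "rmod p n (y n) < of_nat p ^ n" by (rule rmod_bounds)+
  show "rmod p n (y n) = rmod p n (rmod p (Suc n) (y (Suc n)))"
    by (rule rmod_eqI) (meson assms(2) le_SucI order_refl pcong_mono pcong_rmod pcong_sym pcong_trans)
qed

lemma Qp_plike: "x \<in> Qp p \<Longrightarrow> plike p (x n)"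
  unfolding Qp_iff by blast

lemma Qp_rmod [simp]: "x \<in> Qp p \<Longrightarrow> rmod p n (x n) = x n"
  unfolding Qp_iff by (blast intro: rmod_id)

lemma Qp_coh: "x \<in> Qp p \<Longrightarrow> m \<le> n \<Longrightarrow> pcong p m (x n) (x m)"
proof (induction n)
  case (Suc n)
  show ?case
  proof (cases "m = Suc n")
    case False
    then have "m \<le> n" using Suc.prems by simp
    have "x n = rmod p n (x (Suc n))" using Suc.prems(1) unfolding Qp_iff by blast
    then have "pcong p n (x (Suc n)) (x n)" by (metis pcong_rmod pcong_sym)
    then have "pcong p m (x (Suc n)) (x n)" using \<open>m \<le> n\<close> by (rule pcong_mono)
    then show ?thesis using Suc.IH[OF Suc.prems(1) \<open>m \<le> n\<close>] by (rule pcong_trans)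
  qed simp
qed simp

lemma Qp_eq_iff: "x \<in> Qp p \<Longrightarrow> y \<in> Qp p \<Longrightarrow> x n = y n \<longleftrightarrow> pcong p n (x n) (y n)"
  by (metis Qp_rmod rmod_eq_iff)

lemma Qp_eq_0_iff: "x \<in> Qp p \<Longrightarrow> x n = 0 \<longleftrightarrow> pcong p n (x n) 0"
  by (metis Qp_rmod rmod_eq_0)

lemma Qp_level_mono: "x \<in> Qp p \<Longrightarrow> y \<in> Qp p \<Longrightarrow> x n = y n \<Longrightarrow> m \<le> n \<Longrightarrow> x m = y m"
  by (metis Qp_coh Qp_rmod rmod_eq_iff)

lemma Qp_zero_mono: "x \<in> Qp p \<Longrightarrow> x n = 0 \<Longrightarrow> m \<le> n \<Longrightarrow> x m = 0"
  using pcong_sym[OF Qp_coh[of x m n]] by (simp add: Qp_eq_0_iff[of x m])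

lemma qzero_Qp [simp]: "qzero \<in> Qp p"
proof -
  have "plike p 0" using plike_int[of 0] by simp
  then show ?thesis by (auto simp: Qp_iff qzero_def)
qed

lemma qint_Qp [simp]: "qint p a \<in> Qp p"
  unfolding qint_def by (rule Qp_rmodI) auto

lemma Zp_Qp: "x \<in> Zp p \<Longrightarrow> x \<in> Qp p"
  by (simp add: Zp_def)

lemma qint_Zp [simp]: "qint p a \<in> Zp p"
proof -
  have "pcong p 0 (of_int a) 0" unfolding pcong_def by simp
  then show ?thesis unfolding Zp_def using qint_Qp[of a] by (simp add: qint_def rmod_eq_0)
qed

lemma qadd_Qp: "x \<in> Qp p \<Longrightarrow> y \<in> Qp p \<Longrightarrow> qadd p x y \<in> Qp p"
  unfolding qadd_def
  by (rule Qp_rmodI) (simp_all add: plike_add Qp_plike pcong_add pcong_sym[OF Qp_coh])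

lemma qneg_Qp: "x \<in> Qp p \<Longrightarrow> qneg p x \<in> Qp p"
  unfolding qneg_def
  by (rule Qp_rmodI) (simp_all add: plike_minus Qp_plike pcong_minus pcong_sym[OF Qp_coh])

lemma qsub_Qp: "x \<in> Qp p \<Longrightarrow> y \<in> Qp p \<Longrightarrow> qsub p x y \<in> Qp p"
  unfolding qsub_def by (simp add: qadd_Qp qneg_Qp)

lemma qsub_apply: "qsub p x y n = rmod p n (x n - y n)"
proof -
  have "pcong p n (x n + rmod p n (- y n)) (x n + - y n)" by (intro pcong_add) auto
  then show ?thesis unfolding qsub_def qadd_def qneg_def by (simp add: rmod_eq_iff)
qed

lemma qsub_eq_0: "x \<in> Qp p \<Longrightarrow> y \<in> Qp p \<Longrightarrow> qsub p x y n = 0 \<longleftrightarrow> x n = y n"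
  by (simp add: qsub_apply rmod_eq_0 pcong_diff_0 Qp_eq_iff)

text \<open>The difference p^m u is an integer and stays one after multiplication by p^d. Hence a
  power of p that clears the denominator at level 0 clears it at all levels.\<close>

lemma pcong_integral:
  "pcong p m a b \<Longrightarrow> b * of_nat p ^ d = of_int t \<Longrightarrow> \<exists>s. a * of_nat p ^ d = of_int s"
proof -
  assume "pcong p m a b" "b * of_nat p ^ d = of_int t"
  then obtain u where u: "a = b + of_nat p ^ m * of_int u" unfolding pcong_def by (metis add.commute diff_add_cancel)
  have "a * of_nat p ^ d = of_int (t + int p ^ m * u * int p ^ d)"
    using \<open>b * _ = _\<close> by (simp add: u distrib_right)
  then show ?thesis by blast
qed

lemma Qp_integral:
  "x \<in> Qp p \<Longrightarrow> x 0 * of_nat p ^ d = of_int t \<Longrightarrow> \<exists>s. x n * of_nat p ^ d = of_int s"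
  using pcong_integral[OF Qp_coh[of x 0 n]] by simp

lemma qden_spec: "x \<in> Qp p \<Longrightarrow> \<exists>a. x 0 * of_nat p ^ qden p x = of_int a"
proof -
  assume "x \<in> Qp p"
  then obtain a k where "x 0 = of_int a / of_nat p ^ k" using Qp_plike plike_def by metis
  then have "\<exists>a. x 0 * of_nat p ^ k = of_int a" by auto
  then show ?thesis unfolding qden_def by (rule LeastI)
qed

lemma qden_le: "x 0 * of_nat p ^ d = of_int a \<Longrightarrow> qden p x \<le> d"
  unfolding qden_def by (rule Least_le) blast

lemma qden_Zp [simp]: "x \<in> Zp p \<Longrightarrow> qden p x = 0"
  using qden_le[of x 0 0] by (simp add: Zp_def)

lemma Zp_int: "x \<in> Zp p \<Longrightarrow> \<exists>a. x n = of_int a"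
  using Qp_integral[of x 0 0 n] by (simp add: Zp_def)

lemma Qp_int_iff: "x \<in> Qp p \<Longrightarrow> x 0 = 0 \<longleftrightarrow> (\<exists>a. x n = of_int a)"
proof -
  assume x: "x \<in> Qp p"
  have "x 0 = 0" if "x n = of_int a" for a
  proof -
    have "pcong p 0 (x n) 0" unfolding pcong_def that by simp
    then show ?thesis using x Qp_coh[OF x, of 0 n] by (metis Qp_eq_0_iff le0 pcong_sym pcong_trans)
  qed
  then show ?thesis using Zp_int x unfolding Zp_def by blast
qed

text \<open>\<open>qmul\<close> evaluates both factors at level n + \<open>qden p x\<close>, since
  \<open>c\<close> has no denominator. Replacing \<open>c\<close> there by \<open>a\<close> costs at
  most d levels, for any d that bounds the denominator exponent of \<open>x\<close>; lowering
  \<open>x\<close> to level \<open>n\<close> is then free because the other factor is an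
  integer.\<close>

lemma qmul_apply:
  assumes c: "c \<in> Zp p" and x: "x \<in> Qp p" and d: "x 0 * of_nat p ^ d = of_int t"
    and J: "n + d \<le> J" and a: "pcong p J (of_int a) (c J)"
  shows "qmul p c x n = rmod p n (of_int a * x n)"
proof -
  define m where "m = n + qden p x"
  have m: "m \<le> J" using qden_le[of x d t] d J by (simp add: m_def)
  obtain u where u: "x m * of_nat p ^ qden p x = of_int u" using Qp_integral qden_spec x by metis
  obtain e where e: "c m = of_int e" using Zp_int[OF c] by blast
  have "pcong p m (of_int a) (of_int e)"
    using pcong_trans[OF pcong_mono[OF a m] Qp_coh[OF Zp_Qp[OF c] m]] e by simp
  then have "int p ^ m dvd e - a" by (meson pcong_int_dvd pcong_sym)
  then have "pcong p n (of_int (e - a) * x m) 0"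
    using pcong_dvd[OF _ _ u, of m "e - a" n] by (simp add: m_def)
  then have "pcong p n (of_int e * x m) (of_int a * x m)"
    by (simp add: left_diff_distrib pcong_diff_0)
  also have "pcong p n (of_int a * x m) (of_int a * x n)"
    by (rule pcong_mult, rule Qp_coh[OF x]) (simp add: m_def)
  finally show ?thesis
    unfolding qmul_def using e c by (simp add: Let_def m_def[symmetric] rmod_eq_iff)
qed

lemma qmul_apply_int: "x \<in> Qp p \<Longrightarrow> qmul p (qint p c) x n = rmod p n (of_int c * x n)"
  using qden_spec[of x] qmul_apply[OF qint_Zp, of x "qden p x" _ n "n + qden p x" c c]
  by (auto simp: qint_def[THEN fun_cong] pcong_sym)

lemma qmul_Zp_apply: "x \<in> Zp p \<Longrightarrow> y \<in> Zp p \<Longrightarrow> qmul p x y n = rmod p n (x n * y n)"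
  by (simp add: qmul_def)

lemma qmul_Zp: assumes "x \<in> Zp p" "y \<in> Zp p" shows "qmul p x y \<in> Zp p"
proof -
  have "qmul p x y = (\<lambda>n. rmod p n (x n * y n))" using qmul_Zp_apply[OF assms] by blast
  moreover have "(\<lambda>n. rmod p n (x n * y n)) \<in> Qp p"
  proof (rule Qp_rmodI)
    fix n
    obtain a b c where ab: "x n = of_int a" "y n = of_int b" "x (Suc n) = of_int c"
      using Zp_int assms by metis
    show "plike p (x n * y n)" using ab(1) Qp_plike[OF Zp_Qp[OF assms(2)]] plike_mult_int by simp
    have "pcong p n (of_int c * y (Suc n)) (of_int c * y n)"
      using Qp_coh[OF Zp_Qp[OF assms(2)], of n "Suc n"] by (intro pcong_mult) auto
    moreover have "pcong p n (of_int b * x (Suc n)) (of_int b * x n)"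
      using Qp_coh[OF Zp_Qp[OF assms(1)], of n "Suc n"] by (intro pcong_mult) auto
    ultimately show "pcong p n (x n * y n) (x (Suc n) * y (Suc n))"
      using ab by (metis mult.commute pcong_sym pcong_trans)
  qed
  ultimately show ?thesis using assms by (simp add: Zp_def)
qed

lemma qmul_commute: "qmul p x y = qmul p y x"
  by (simp add: qmul_def ac_simps)

text \<open>Only the valuation of \<open>n\<close> matters: the part of \<open>n\<close> prime to \<open>p\<close> is cancelled,
  the rest costs a bounded number of levels.\<close>

lemma Qp_torsion_free:
  assumes x: "x \<in> Qp p" and n: "n > 0" and eq: "\<And>m. pcong p m (of_int (int n) * x m) 0"
  shows "x m = 0"
proof -
  obtain v u where vu: "n = p ^ v * u" "\<not> p dvd u"
    using prime_power_canonical[OF prime_p n] by (metis mult.commute)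
  define M where "M = m + v"
  obtain b k where b: "x M = of_int b / of_nat p ^ k" using Qp_plike[OF x] plike_def by metis
  obtain t where t: "of_int (int n) * x M = of_nat p ^ M * of_int t"
    using eq[of M] unfolding pcong_def by auto
  have "of_int (int n) * x M * of_nat p ^ k = (of_int (int p ^ v * (int u * b)) :: rat)"
    by (simp add: b vu)
  also have "of_int (int n) * x M * of_nat p ^ k = (of_int (int p ^ v * (int p ^ m * t * int p ^ k)) :: rat)"
    unfolding t by (simp add: M_def power_add)
  finally have "int p ^ v * (int p ^ m * t * int p ^ k) = int p ^ v * (int u * b)"
    unfolding of_int_eq_iff .
  then have "int u * b = int p ^ (m + k) * t" by (simp add: power_add ac_simps)
  moreover have "coprime (int p ^ (m + k)) (int u)"
    using vu(2) prime_p by (simp add: prime_imp_coprime)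
  ultimately have "int p ^ (m + k) dvd b"
    by (metis coprime_dvd_mult_right_iff dvd_triv_left)
  then obtain s where "b = int p ^ (m + k) * s" by (auto simp: dvd_def)
  then have "x M - 0 = of_nat p ^ m * of_int s" using b by (simp add: power_add)
  then have "pcong p m (x M) 0" unfolding pcong_def by blast
  then show ?thesis
    using Qp_coh[OF x, of m M] by (metis M_def Qp_eq_0_iff le_add1 pcong_sym pcong_trans x)
qed

text \<open>The quotient x / p^m is read off m levels further up: a congruence modulo p^(n + m)
  becomes one modulo p^n after division by p^m. The hypothesis on \<open>x m\<close> makes the
  quotient integral.\<close>

lemma Qp_divide:
  assumes x: "x \<in> Qp p" and 0: "x m = 0"
  shows "\<exists>y \<in> Zp p. \<forall>n. pcong p n (of_int (int p ^ m) * y n) (x n)"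
proof -
  define z where "z = (\<lambda>n. x (n + m) / of_nat p ^ m)"
  define y where "y = (\<lambda>n. rmod p n (z n))"
  have yz: "pcong p n (y n) (z n)" for n unfolding y_def by simp
  have y: "y \<in> Qp p" unfolding y_def
  proof (rule Qp_rmodI)
    fix n
    show "plike p (z n)" unfolding z_def by (intro plike_divp Qp_plike x)
    have "pcong p (n + m) (x (n + m)) (x (Suc n + m))" using Qp_coh[OF x] by (simp add: pcong_sym)
    then obtain t where t: "x (n + m) - x (Suc n + m) = of_nat p ^ (n + m) * of_int t"
      unfolding pcong_def by auto
    have "z n - z (Suc n) = of_nat p ^ n * of_int t"
      unfolding z_def diff_divide_distrib[symmetric] t by (simp add: power_add)
    then show "pcong p n (z n) (z (Suc n))" unfolding pcong_def by blast
  qed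
  moreover have "y 0 = 0" unfolding y_def z_def using 0 by simp
  moreover have "pcong p n (of_int (int p ^ m) * y n) (x n)" for n
  proof -
    have "pcong p n (of_int (int p ^ m) * y n) (of_int (int p ^ m) * z n)"
      by (intro pcong_mult yz)
    also have "of_int (int p ^ m) * z n = x (n + m)" by (simp add: z_def)
    also have "pcong p n (x (n + m)) (x n)" by (intro Qp_coh x) simp
    finally show ?thesis .
  qed
  ultimately show ?thesis unfolding Zp_def by blast
qed

section \<open>The p-adic norm in terms of vanishing residues\<close>

lemma qnorm_ge_0: "0 \<le> qnorm p x"
  by (simp add: qnorm_def)

lemma qnorm_nonint: assumes x: "x \<in> Qp p" "x 0 \<noteq> 0" shows "qnorm p x > 1"
proof -
  have "qden p x \<noteq> 0"
  proof
    assume "qden p x = 0"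
    then obtain a where "x 0 = of_int a" using qden_spec[OF x(1)] by auto
    then show False using Qp_int_iff[OF x(1), of 0] x(2) by blast
  qed
  moreover have "x \<noteq> qzero" using x by (auto simp: qzero_def)
  ultimately show ?thesis using x p_gt_1 by (simp add: qnorm_def one_less_power)
qed

lemma Zp_qnorm:
  assumes x: "x \<in> Zp p" "x \<noteq> qzero"
  shows "\<exists>k. qnorm p x = inverse (real p ^ k) \<and> x k = 0 \<and> x (Suc k) \<noteq> 0"
proof -
  have "\<exists>n. x n \<noteq> 0" using x(2) unfolding qzero_def by auto
  then have l: "x (LEAST n. x n \<noteq> 0) \<noteq> 0" by (rule LeastI_ex)
  have x0: "x 0 = 0" using x by (simp add: Zp_def)
  then obtain k where k: "(LEAST n. x n \<noteq> 0) = Suc k" using l by (metis old.nat.exhaust)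
  then have "x k = 0" using not_less_Least[of k "\<lambda>n. x n \<noteq> 0"] by auto
  then show ?thesis using l k x0 x(2) by (auto simp: qnorm_def)
qed

lemma inverse_power_less: "inverse (real p ^ k) < inverse (real p ^ m) \<longleftrightarrow> m < k"
  using p_gt_1 by (simp add: inverse_less_iff_less)

text \<open>A nonintegral element has norm above 1; a nonzero integral one has norm p^(-k) with k
  its last vanishing level. This turns metric conditions into conditions on residues.\<close>

lemma qnorm_le_iff:
  assumes x: "x \<in> Qp p"
  shows "qnorm p x \<le> inverse (real p ^ m) \<longleftrightarrow> x m = 0"
proof (cases "x 0 = 0")
  case False
  then have "x m \<noteq> 0" using Qp_zero_mono x by blast
  moreover have "inverse (real p ^ m) \<le> 1" using p_gt_1 by (simp add: inverse_le_1_iff)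
  ultimately show ?thesis using qnorm_nonint[OF x False] by auto
next
  case True
  show ?thesis
  proof (cases "x = qzero")
    case False
    then obtain k where k: "qnorm p x = inverse (real p ^ k)" "x k = 0" "x (Suc k) \<noteq> 0"
      using Zp_qnorm[of x] False True x by (auto simp: Zp_def)
    have "x m = 0 \<longleftrightarrow> m \<le> k"
      using k Qp_zero_mono[OF x, of k m] Qp_zero_mono[OF x, of m "Suc k"] not_less_eq_eq by blast
    moreover have "qnorm p x \<le> inverse (real p ^ m) \<longleftrightarrow> m \<le> k"
      unfolding k(1) using inverse_power_less[of m k] by (auto simp: not_less[symmetric])
    ultimately show ?thesis by simp
  qed (simp add: qnorm_def qzero_def)
qed

text \<open>Norms are discrete: the next possible value below p^(-m) is p^(-m-1), so a strict
  inequality gains one level.\<close>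

lemma qnorm_less:
  assumes x: "x \<in> Qp p" and less: "qnorm p x < inverse (real p ^ m)"
  shows "x (Suc m) = 0"
proof (rule ccontr)
  assume n: "x (Suc m) \<noteq> 0"
  have "x m = 0" using less qnorm_le_iff[OF x, of m] by linarith
  then have "x 0 = 0" using Qp_zero_mono[OF x] by blast
  then obtain k where k: "qnorm p x = inverse (real p ^ k)" "x k = 0" "x (Suc k) \<noteq> 0"
    using Zp_qnorm[of x] n x by (auto simp: Zp_def qzero_def)
  then have "m < k" using less inverse_power_less[of k m] by simp
  then show False using n Qp_zero_mono[OF x k(2), of "Suc m"] by simp
qed

lemma small_power: "\<epsilon> > 0 \<Longrightarrow> \<exists>m. inverse (real p ^ m) < \<epsilon>"
proof -
  assume "\<epsilon> > 0"
  moreover have "inverse (real p) < 1" using p_gt_1 by (simp add: inverse_less_1_iff)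
  ultimately obtain m where "inverse (real p) ^ m < \<epsilon>"
    using real_arch_pow_inv by blast
  then show ?thesis unfolding power_inverse by blast
qed

lemma Zp_le_1: "x \<in> Zp p \<Longrightarrow> qnorm p x \<le> 1"
  using qnorm_le_iff[of x 0] by (simp add: Zp_def)

lemma qnorm_qsub_le_iff:
  "x \<in> Qp p \<Longrightarrow> y \<in> Qp p \<Longrightarrow> qnorm p (qsub p x y) \<le> inverse (real p ^ m) \<longleftrightarrow> x m = y m"
  by (simp add: qnorm_le_iff qsub_Qp qsub_eq_0)

lemma qnorm_qsub_less:
  "x \<in> Qp p \<Longrightarrow> y \<in> Qp p \<Longrightarrow> qnorm p (qsub p x y) < inverse (real p ^ m) \<Longrightarrow> x (Suc m) = y (Suc m)"
  using qnorm_less[of "qsub p x y" m] by (simp add: qsub_Qp qsub_eq_0)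

end

section \<open>Mahler coefficients of integer sequences\<close>

definition fdiff :: "(nat \<Rightarrow> int) \<Rightarrow> nat \<Rightarrow> int" where
  "fdiff g = (\<lambda>k. g (Suc k) - g k)"

definition mahler :: "(nat \<Rightarrow> int) \<Rightarrow> nat \<Rightarrow> int" where
  "mahler g n = (fdiff ^^ n) g 0"

lemma fdiff_pow_linear:
  "(fdiff ^^ n) (\<lambda>k. a * g k + b * h k) = (\<lambda>k. a * (fdiff ^^ n) g k + b * (fdiff ^^ n) h k)"
  by (induction n) (auto simp: fdiff_def algebra_simps)

lemma fdiff_pow_dvd: "(\<And>k. q dvd g k) \<Longrightarrow> q dvd (fdiff ^^ n) g k"
  by (induction n arbitrary: k) (auto simp: fdiff_def)

lemma mahler_linear: "mahler (\<lambda>k. a * g k + b * h k) n = a * mahler g n + b * mahler h n"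
  by (simp add: mahler_def fdiff_pow_linear)

lemma mahler_add: "mahler (\<lambda>k. g k + h k) n = mahler g n + mahler h n"
  using mahler_linear[of 1 g 1 h] by simp

lemma mahler_diff: "mahler (\<lambda>k. g k - h k) n = mahler g n - mahler h n"
  using mahler_linear[of 1 g "-1" h] by simp

lemma mahler_mult: "mahler (\<lambda>k. a * g k) n = a * mahler g n"
  using mahler_linear[of a g 0 g] by simp

lemma mahler_sum: "finite S \<Longrightarrow> mahler (\<lambda>k. \<Sum>i\<in>S. f i k) n = (\<Sum>i\<in>S. mahler (f i) n)"
proof (induction S rule: finite_induct)
  case empty
  then show ?case using mahler_mult[of 0 "\<lambda>_. 0" n] by simp
qed (simp add: mahler_add)

lemma mahler_dvd: "(\<And>k. q dvd g k) \<Longrightarrow> q dvd mahler g n"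
  by (simp add: mahler_def fdiff_pow_dvd)

lemma fdiff_binomial: "fdiff (\<lambda>k. int (k choose Suc n)) = (\<lambda>k. int (k choose n))"
  by (simp add: fdiff_def)

lemma fdiff_pow_const: "(fdiff ^^ n) (\<lambda>_. c) k = (if n = 0 then c else 0)"
  by (induction n arbitrary: k) (auto simp: fdiff_def)

lemma mahler_const: "mahler (\<lambda>_. c) n = (if n = 0 then c else 0)"
  by (simp add: mahler_def fdiff_pow_const)

lemma mahler_Suc: "mahler g (Suc n) = mahler (fdiff g) n"
  by (simp add: mahler_def funpow_swap1)

lemma mahler_binomial: "mahler (\<lambda>k. int (k choose m)) n = (if n = m then 1 else 0)"
proof (induction n arbitrary: m)
  case 0
  then show ?case by (cases m) (auto simp: mahler_def)
next
  case (Suc n)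
  show ?case
  proof (cases m)
    case 0
    then show ?thesis using mahler_const[of 1] by simp
  next
    case (Suc m')
    then show ?thesis using Suc.IH[of m'] by (simp only: mahler_Suc fdiff_binomial) simp
  qed
qed

text \<open>Leibniz rule for a product with the identity: the correction is n times the shifted
  difference of order n - 1, and a shift is the identity plus a difference. For n = 0 the truncated
  \<open>n - 1\<close> is multiplied by 0.\<close>

lemma fdiff_pow_mult_id:
  "(fdiff ^^ n) (\<lambda>k. int k * g k) x =
     int x * (fdiff ^^ n) g x + int n * ((fdiff ^^ n) g x + (fdiff ^^ (n - 1)) g x)"
proof (induction n arbitrary: x)
  case (Suc n)
  have eq: "(fdiff ^^ n) g (Suc y) = (fdiff ^^ Suc n) g y + (fdiff ^^ n) g y" for y
    by (simp add: fdiff_def)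
  show ?case
  proof (cases n)
    case 0
    then show ?thesis by (simp add: fdiff_def algebra_simps)
  next
    case (Suc k)
    have eq': "(fdiff ^^ k) g (Suc y) = (fdiff ^^ n) g y + (fdiff ^^ k) g y" for y
      by (simp add: fdiff_def Suc)
    have "(fdiff ^^ Suc n) (\<lambda>k. int k * g k) x =
        (fdiff ^^ n) (\<lambda>k. int k * g k) (Suc x) - (fdiff ^^ n) (\<lambda>k. int k * g k) x"
      by (simp add: fdiff_def)
    also have "\<dots> = int (Suc x) * (fdiff ^^ Suc n) g x + int (Suc x) * (fdiff ^^ n) g x
        + int n * ((fdiff ^^ Suc n) g x + (fdiff ^^ n) g x + (fdiff ^^ n) g x + (fdiff ^^ k) g x)
        - (int x * (fdiff ^^ n) g x + int n * ((fdiff ^^ n) g x + (fdiff ^^ k) g x))"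
      unfolding Suc.IH by (simp only: eq) (simp only: Suc diff_Suc_1 eq'[unfolded Suc] distrib_left)
    also have "\<dots> = int x * (fdiff ^^ Suc n) g x + int (Suc n) * ((fdiff ^^ Suc n) g x + (fdiff ^^ n) g x)"
      by (simp only: of_nat_Suc) (simp only: algebra_simps)
    finally show ?thesis by simp
  qed
qed simp

text \<open>Coefficient form of x (x choose n) = n (x choose n) + (n + 1) (x choose (n + 1));
  \<open>A_B\<close> is the same recursion for operators.\<close>

lemma mahler_mult_id:
  "mahler (\<lambda>k. int k * g k) n = int n * (mahler g n + mahler g (n - 1))"
  by (simp add: mahler_def fdiff_pow_mult_id)

text \<open>The shift is 1 plus the difference operator; its x-th power is expanded by the binomial
  theorem.\<close>

lemma newton: "g x = (\<Sum>n\<le>x. int (x choose n) * mahler g n)"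
proof -
  \<comment> \<open>The base point must vary, because the induction step moves it from y to y +
    1.\<close>
  have "g (y + x) = (\<Sum>n\<le>x. int (x choose n) * (fdiff ^^ n) g y)" for y
  proof (induction x arbitrary: y)
    case (Suc x)
    let ?D = "\<lambda>n. (fdiff ^^ n) g y"
    have "g (y + Suc x) = (\<Sum>n\<le>x. int (x choose n) * (fdiff ^^ n) g (Suc y))"
      using Suc.IH[of "Suc y"] by simp
    also have "\<dots> = (\<Sum>n\<le>x. int (x choose n) * ?D n) + (\<Sum>n\<le>x. int (x choose n) * ?D (Suc n))"
      unfolding sum.distrib[symmetric] by (rule sum.cong) (auto simp: fdiff_def algebra_simps)
    also have "(\<Sum>n\<le>x. int (x choose n) * ?D n) = (\<Sum>n\<le>Suc x. int (x choose n) * ?D n)"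
      by simp
    also have "\<dots> = ?D 0 + (\<Sum>n\<le>x. int (x choose Suc n) * ?D (Suc n))"
      by (subst sum.atMost_Suc_shift) simp
    also have "\<dots> + (\<Sum>n\<le>x. int (x choose n) * ?D (Suc n)) =
        ?D 0 + (\<Sum>n\<le>x. int (Suc x choose Suc n) * ?D (Suc n))"
      by (simp add: sum.distrib distrib_right del: funpow.simps)
    also have "\<dots> = (\<Sum>n\<le>Suc x. int (Suc x choose n) * ?D n)"
      by (subst sum.atMost_Suc_shift) simp
    finally show ?case .
  qed simp
  from this[of 0] show ?thesis by (simp add: mahler_def)
qed

definition mtrunc :: "nat \<Rightarrow> (nat \<Rightarrow> int) \<Rightarrow> nat \<Rightarrow> int" where
  "mtrunc N g x = (\<Sum>n<N. mahler g n * int (x choose n))"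

lemma mahler_mtrunc: "mahler (mtrunc N g) n = (if n < N then mahler g n else 0)"
proof -
  have "mahler (mtrunc N g) n = (\<Sum>i<N. mahler (\<lambda>x. mahler g i * int (x choose i)) n)"
    unfolding mtrunc_def by (rule mahler_sum) simp
  also have "\<dots> = (\<Sum>i<N. if n = i then mahler g i else 0)"
    by (rule sum.cong) (auto simp: mahler_mult mahler_binomial)
  finally show ?thesis by simp
qed

text \<open>By Newton's formula a sequence is divisible by \<open>q\<close> once its Mahler
  coefficients are. Those of the difference are 0 below \<open>N\<close> and, up to sign, those of
  \<open>g\<close> from \<open>N\<close> on.\<close>

lemma dvd_mtrunc:
  assumes "\<And>n. n \<ge> N \<Longrightarrow> q dvd mahler g n"
  shows "q dvd mtrunc N g x - g x"
proof -
  let ?h = "\<lambda>x. mtrunc N g x - g x"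
  have "q dvd mahler ?h n" for n
    using assms[of n] by (auto simp: mahler_diff mahler_mtrunc)
  then show ?thesis by (subst newton) (auto intro!: dvd_sum dvd_mult)
qed

text \<open>Scalar counterpart of \<open>falling_op\<close>, with the same recursion.\<close>

primrec falling :: "nat \<Rightarrow> nat \<Rightarrow> int" where
  "falling 0 x = 1"
| "falling (Suc n) x = (int x - int n) * falling n x"

lemma falling_eq: "falling n x = fact n * int (x choose n)"
proof (induction n)
  case (Suc n)
  have *: "int (Suc n) * int (x choose Suc n) = (int x - int n) * int (x choose n)"
  proof (cases "n \<le> x")
    case True
    have "Suc n * (x choose Suc n) = (x - n) * (x choose n)"
      by (simp only: binomial_absorption binomial_absorb_comp)
    then show ?thesis unfolding of_nat_diff[OF True, symmetric] of_nat_mult[symmetric] by simp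
  qed (simp add: binomial_eq_0)
  have "falling (Suc n) x = fact n * (int (Suc n) * int (x choose Suc n))"
    unfolding * by (simp add: Suc.IH)
  then show ?case by simp
qed simp

section \<open>Higher differences of sequences that are periodic modulo a power of p\<close>

lemma fdiff_pow_binomial_sum:
  "(fdiff ^^ n) g x = (\<Sum>i\<le>n. (-1) ^ (n - i) * int (n choose i) * g (x + i))"
proof (induction n arbitrary: x)
  case (Suc n)
  let ?c = "\<lambda>n i. (-1) ^ (n - i) * int (n choose i)"
  have c: "?c (Suc n) (Suc i) = ?c n i - ?c n (Suc i)" if "i \<le> n" for i
  proof (cases "i = n")
    case False
    with that have "n - i = Suc (n - Suc i)" by simp
    then show ?thesis by (simp add: algebra_simps)
  qed simp
  have "(fdiff ^^ Suc n) g x = (\<Sum>i\<le>n. ?c n i * g (Suc x + i)) - (\<Sum>i\<le>n. ?c n i * g (x + i))"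
    unfolding Suc.IH[symmetric] by (simp add: fdiff_def)
  also have "(\<Sum>i\<le>n. ?c n i * g (x + i)) = (\<Sum>i\<le>Suc n. ?c n i * g (x + i))"
    by simp
  also have "\<dots> = (-1) ^ n * g x + (\<Sum>i\<le>n. ?c n (Suc i) * g (x + Suc i))"
    by (subst sum.atMost_Suc_shift) simp
  also have "(\<Sum>i\<le>n. ?c n i * g (Suc x + i)) - \<dots> =
      (-1) ^ Suc n * g x + (\<Sum>i\<le>n. (?c n i - ?c n (Suc i)) * g (x + Suc i))"
    by (simp add: sum_subtractf left_diff_distrib)
  also have "\<dots> = (-1) ^ Suc n * g x + (\<Sum>i\<le>n. ?c (Suc n) (Suc i) * g (x + Suc i))"
    using c by simp
  also have "\<dots> = (\<Sum>i\<le>Suc n. ?c (Suc n) i * g (x + i))"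
    by (subst sum.atMost_Suc_shift) simp
  finally show ?case .
qed simp

text \<open>By absorption, i (q choose i) is a multiple of q = p^N. If the binomial coefficient were
  prime to p, then q would divide i, which is too small.\<close>

lemma prime_dvd_prime_power_choose:
  assumes "prime (p :: nat)" "0 < i" "i < p ^ N"
  shows "p dvd (p ^ N choose i)"
proof (rule ccontr)
  assume "\<not> p dvd (p ^ N choose i)"
  then have "coprime (p ^ N) (p ^ N choose i)" using assms(1) by (simp add: prime_imp_coprime)
  moreover have "p ^ N dvd i * (p ^ N choose i)"
    using binomial_absorption[of "i - 1" "p ^ N"] assms(2) by simp
  ultimately have "p ^ N dvd i" by (simp add: coprime_dvd_mult_left_iff)
  then show False using assms by (simp add: dvd_imp_le nat_dvd_not_less)
qed

text \<open>With \<open>E\<close> the shift, modulo \<open>p\<close> the operator \<open>(E - 1)\<^bsup>q\<^esup>\<close> with \<open>q = p\<^bsup>N\<^esup>\<close> is \<open>E\<^bsup>q\<^esup> - 1\<close>, so each application of it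
  to a sequence that is \<open>q\<close>-periodic modulo \<open>p\<^bsup>J\<^esup>\<close> gains a factor \<open>p\<close>.\<close>

lemma fdiff_pow_prime_power_gain:
  fixes p :: nat
  assumes p: "prime p" and per: "\<And>x. int p ^ J dvd g (x + p ^ N) - g x"
    and j: "j < J" and dvd: "\<And>x. int p ^ j dvd g x"
  shows "int p ^ Suc j dvd (fdiff ^^ (p ^ N)) g x"
proof -
  define q where "q = p ^ N"
  have q: "q > 0" using p prime_gt_0_nat by (simp add: q_def)
  let ?t = "\<lambda>i. (-1) ^ (q - i) * int (q choose i) * g (x + i)"
  have "(\<Sum>i\<le>q. ?t i) = (\<Sum>i\<in>{0<..<q}. ?t i) + ?t 0 + ?t q"
  proof -
    have "{..q} = insert 0 (insert q {0<..<q})" using q by auto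
    then show ?thesis using q by simp
  qed
  moreover have "int p ^ Suc j dvd ?t i" if i: "i \<in> {0<..<q}" for i
  proof -
    have "int p dvd int (q choose i)"
      using prime_dvd_prime_power_choose[OF p, of i N] i unfolding q_def by simp
    then have "int p * int p ^ j dvd int (q choose i) * g (x + i)"
      using dvd by (intro mult_dvd_mono)
    then show ?thesis by (simp add: mult.assoc)
  qed
  \<comment> \<open>The end terms sum to (g(x + q) - g x) + (1 + (-1)^q) g x. Periodicity handles
    the first bracket; the sign factor is 0 for odd p and even for p = 2.\<close>
  moreover have "int p ^ Suc j dvd ?t 0 + ?t q"
  proof -
    have 1: "int p ^ Suc j dvd g (x + q) - g x"
      using per[of x] j unfolding q_def by (meson Suc_leI dvd_trans le_imp_power_dvd)
    have "int p ^ Suc j dvd (1 + (-1) ^ q) * g x"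
    proof (cases "p = 2")
      case True
      have "(1 + (-1) ^ q :: int) = 2 \<or> (1 + (-1) ^ q :: int) = 0"
        by (cases "even q") auto
      then have "int p dvd 1 + (-1) ^ q" using True by auto
      then show ?thesis using dvd[of x] by (simp add: mult_dvd_mono)
    next
      case False
      then have "odd q" using p prime_odd_nat[of p] prime_ge_2_nat[OF p] unfolding q_def by auto
      then show ?thesis by simp
    qed
    from dvd_add[OF 1 this] show ?thesis by (simp add: algebra_simps)
  qed
  ultimately show ?thesis
    unfolding fdiff_pow_binomial_sum q_def[symmetric] by (simp only:) (simp only: dvd_add dvd_sum add.assoc)
qed

text \<open>Shifts commute with differences, so each iterated difference of \<open>g\<close> is
  again periodic modulo p^J and the gain can be repeated. J rounds of p^N differences give p^J, and
  further differences preserve divisibility.\<close>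

lemma mahler_periodic:
  fixes p :: nat
  assumes p: "prime p" and per: "\<And>x. int p ^ J dvd g (x + p ^ N) - g x"
    and n: "n \<ge> J * p ^ N"
  shows "int p ^ J dvd mahler g n"
proof -
  define q where "q = p ^ N"
  have "j \<le> J \<Longrightarrow> int p ^ j dvd (fdiff ^^ (j * q)) g x" for j x
  proof (induction j arbitrary: x)
    case (Suc j)
    let ?h = "(fdiff ^^ (j * q)) g"
    have shift: "(fdiff ^^ k) (\<lambda>x. g (x + q)) y = (fdiff ^^ k) g (y + q)" for k y
      by (induction k arbitrary: y) (auto simp: fdiff_def)
    have "(fdiff ^^ (j * q)) (\<lambda>x. g (x + q) - g x) y = ?h (y + q) - ?h y" for y
      using fdiff_pow_linear[of "j * q" 1 "\<lambda>x. g (x + q)" "-1" g] by (simp add: shift)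
    then have "int p ^ J dvd ?h (y + q) - ?h y" for y
      using fdiff_pow_dvd[of "int p ^ J" "\<lambda>x. g (x + q) - g x"] per unfolding q_def by metis
    then have "int p ^ Suc j dvd (fdiff ^^ q) ?h x"
      using Suc unfolding q_def by (intro fdiff_pow_prime_power_gain[OF p, of J]) auto
    then show ?case by (simp add: funpow_add)
  qed simp
  then have "int p ^ J dvd (fdiff ^^ (n - J * q)) ((fdiff ^^ (J * q)) g) 0"
    using fdiff_pow_dvd[of "int p ^ J" "(fdiff ^^ (J * q)) g"] by blast
  moreover have "(fdiff ^^ (n - J * q)) ((fdiff ^^ (J * q)) g) = (fdiff ^^ n) g"
    using n unfolding q_def by (simp add: funpow_add[THEN fun_cong, unfolded o_apply, symmetric])
  ultimately show ?thesis by (simp add: mahler_def)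
qed

section \<open>Continuous functions on the p-adic integers\<close>

context prime_base
begin

definition unif_cont :: "(qp \<Rightarrow> qp) \<Rightarrow> bool" where
  "unif_cont f \<longleftrightarrow> (\<forall>z \<in> Zp p. f z \<in> Zp p) \<and>
     (\<forall>J. \<exists>N. \<forall>z \<in> Zp p. \<forall>w \<in> Zp p. z N = w N \<longrightarrow> f z J = f w J)"

lemma Zp_level_nat: "z \<in> Zp p \<Longrightarrow> \<exists>k < int p ^ N. z N = of_int k \<and> 0 \<le> k"
proof -
  assume z: "z \<in> Zp p"
  obtain k where k: "z N = of_int k" using Zp_int[OF z] by blast
  have "0 \<le> z N" "z N < of_nat p ^ N" using Qp_bounds[OF Zp_Qp[OF z]] by blast+
  then have "of_int 0 \<le> (of_int k :: rat)" "(of_int k :: rat) < of_int (int p ^ N)" using k by simp_all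
  then show ?thesis using k unfolding of_int_le_iff of_int_less_iff by blast
qed

lemma finite_Zp_level: "finite {z N | z. z \<in> Zp p}"
proof (rule finite_subset)
  show "{z N | z. z \<in> Zp p} \<subseteq> of_int ` {0..<int p ^ N}"
  proof
    fix r assume "r \<in> {z N | z. z \<in> Zp p}"
    then obtain z where "z \<in> Zp p" "r = z N" by blast
    then show "r \<in> of_int ` {0..<int p ^ N}" using Zp_level_nat[of z N] by auto
  qed
qed simp

text \<open>A failure of uniform continuity is inherited by one of the finitely many residue classes
  of the next level; the residues chosen successively form a point of discontinuity.\<close>

lemma CZ_unif_cont:
  assumes f: "f \<in> CZ p"
  shows "unif_cont f"
proof -
  have fZ: "f z \<in> Zp p" if "z \<in> Zp p" for z using f that unfolding CZ_def by auto
  have "\<exists>N. \<forall>z \<in> Zp p. \<forall>w \<in> Zp p. z N = w N \<longrightarrow> f z J = f w J" for J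
  proof (rule ccontr)
    define bad where "bad N r \<longleftrightarrow> (\<forall>M. \<exists>z \<in> Zp p. \<exists>w \<in> Zp p. z N = r \<and> w N = r \<and> z M = w M \<and> f z J \<noteq> f w J)"
      for N r
    assume contra: "\<not> ?thesis"
    have "\<exists>r. \<forall>N. bad N (r N) \<and> r N = rmod p N (r (Suc N))"
    proof (rule dependent_nat_choice)
      have "bad 0 0" unfolding bad_def
      proof
        fix M
        obtain z w where "z \<in> Zp p" "w \<in> Zp p" "z M = w M" "f z J \<noteq> f w J" using contra by blast
        then show "\<exists>z \<in> Zp p. \<exists>w \<in> Zp p. z 0 = 0 \<and> w 0 = 0 \<and> z M = w M \<and> f z J \<noteq> f w J"
          unfolding Zp_def by blast
      qed
      then show "\<exists>r. bad 0 r" ..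
    next
      fix r N assume bad: "bad N r"
      show "\<exists>r'. bad (Suc N) r' \<and> r = rmod p N r'"
      proof (rule ccontr)
        assume "\<not> ?thesis"
        then have "\<forall>r'. \<exists>M. r = rmod p N r' \<longrightarrow>
            (\<forall>z \<in> Zp p. \<forall>w \<in> Zp p. z (Suc N) = r' \<longrightarrow> w (Suc N) = r' \<longrightarrow> z M = w M \<longrightarrow> f z J = f w J)"
          unfolding bad_def by blast
        from choice[OF this] obtain M where M: "\<forall>r'. r = rmod p N r' \<longrightarrow>
            (\<forall>z \<in> Zp p. \<forall>w \<in> Zp p. z (Suc N) = r' \<longrightarrow> w (Suc N) = r' \<longrightarrow> z (M r') = w (M r') \<longrightarrow> f z J = f w J)" ..
        define R where "R = {z (Suc N) | z. z \<in> Zp p}"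
        have R: "finite (M ` R)" unfolding R_def using finite_Zp_level by blast
        \<comment> \<open>If every subclass failed to be bad, it would have its own threshold
          \<open>M\<close>. \<open>K\<close> exceeds all these finitely many thresholds and Suc N,
          so a bad pair agreeing at level \<open>K\<close> lies in one subclass and beats its
          threshold.\<close>
        define K where "K = Max (insert (Suc N) (M ` R))"
        obtain z w where zw: "z \<in> Zp p" "w \<in> Zp p" "z N = r" "z K = w K" "f z J \<noteq> f w J"
          using bad unfolding bad_def by blast
        have "z (Suc N) \<in> R" using zw(1) unfolding R_def by blast
        then have K: "Suc N \<le> K" "M (z (Suc N)) \<le> K" unfolding K_def using R by auto
        have "z (Suc N) = w (Suc N)" "z (M (z (Suc N))) = w (M (z (Suc N)))"
          using Qp_level_mono[OF Zp_Qp[OF zw(1)] Zp_Qp[OF zw(2)] zw(4)] K by auto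
        moreover have "r = rmod p N (z (Suc N))"
          unfolding zw(3)[symmetric] by (rule Qp_step[OF Zp_Qp[OF zw(1)]])
        ultimately show False using M zw(1,2,5) by metis
      qed
    qed
    then obtain r where r: "\<And>N. bad N (r N)" "\<And>N. r N = rmod p N (r (Suc N))" by blast
    have rz: "\<exists>z \<in> Zp p. z N = r N" for N using r(1)[of N] unfolding bad_def by blast
    have "r \<in> Qp p"
      unfolding Qp_iff
    proof (intro allI conjI r(2))
      fix N
      obtain z where z: "z \<in> Qp p" "z N = r N" using rz Zp_Qp by blast
      show "plike p (r N)" "0 \<le> r N" "r N < of_nat p ^ N"
        unfolding z(2)[symmetric] using Qp_plike[OF z(1)] Qp_bounds[OF z(1)] by blast+
    qed
    moreover have "r 0 = 0" using rz[of 0] unfolding Zp_def by auto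
    ultimately have rZ: "r \<in> Zp p" by (simp add: Zp_def)
    have "inverse (real p ^ J) > 0" by simp
    then obtain \<delta> where \<delta>: "\<delta> > 0" "\<And>w. \<lbrakk>w \<in> Zp p; qnorm p (qsub p w r) < \<delta>\<rbrakk>
        \<Longrightarrow> qnorm p (qsub p (f w) (f r)) < inverse (real p ^ J)"
      using f rZ unfolding CZ_def Zp_continuous_def mem_Collect_eq by meson
    obtain N where N: "inverse (real p ^ N) < \<delta>" using small_power \<delta>(1) by blast
    have near: "f w J = f r J" if w: "w \<in> Zp p" "w N = r N" for w
    proof -
      have "qnorm p (qsub p w r) \<le> inverse (real p ^ N)"
        using qnorm_qsub_le_iff[OF Zp_Qp[OF w(1)] Zp_Qp[OF rZ]] w(2) by blast
      then have "qnorm p (qsub p w r) < \<delta>" using N by linarith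
      from qnorm_qsub_less[OF Zp_Qp[OF fZ[OF w(1)]] Zp_Qp[OF fZ[OF rZ]] \<delta>(2)[OF w(1) this]]
      have "f w (Suc J) = f r (Suc J)" .
      then show ?thesis
        using Qp_level_mono[OF Zp_Qp[OF fZ[OF w(1)]] Zp_Qp[OF fZ[OF rZ]], of "Suc J" J] by simp
    qed
    moreover obtain z w where "z \<in> Zp p" "w \<in> Zp p" "z N = r N" "w N = r N" "f z J \<noteq> f w J"
      using r(1)[of N] unfolding bad_def by blast
    ultimately show False by metis
  qed
  then show ?thesis unfolding unif_cont_def using fZ by blast
qed

lemma unif_cont_Zp: "unif_cont f \<Longrightarrow> z \<in> Zp p \<Longrightarrow> f z \<in> Zp p"
  by (simp add: unif_cont_def)

text \<open>Pointwise ring operations act level by level, so the larger of the two moduli of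
  continuity serves.\<close>

lemma unif_cont_binary:
  assumes f: "unif_cont f" and g: "unif_cont g"
    and Z: "\<And>z. z \<in> Zp p \<Longrightarrow> h z \<in> Zp p"
    and h: "\<And>z w J. \<lbrakk>z \<in> Zp p; w \<in> Zp p; f z J = f w J; g z J = g w J\<rbrakk> \<Longrightarrow> h z J = h w J"
  shows "unif_cont h"
  unfolding unif_cont_def
proof (intro conjI ballI allI Z)
  fix J
  obtain N where N: "\<forall>z \<in> Zp p. \<forall>w \<in> Zp p. z N = w N \<longrightarrow> f z J = f w J"
    using f unfolding unif_cont_def by blast
  obtain M where M: "\<forall>z \<in> Zp p. \<forall>w \<in> Zp p. z M = w M \<longrightarrow> g z J = g w J"
    using g unfolding unif_cont_def by blast
  have "h z J = h w J" if zw: "z \<in> Zp p" "w \<in> Zp p" "z (max N M) = w (max N M)" for z w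
  proof -
    have "z N = w N" "z M = w M"
      using Qp_level_mono[OF Zp_Qp[OF zw(1)] Zp_Qp[OF zw(2)] zw(3)] by simp_all
    then show ?thesis using h zw N M by blast
  qed
  then show "\<exists>N. \<forall>z \<in> Zp p. \<forall>w \<in> Zp p. z N = w N \<longrightarrow> h z J = h w J" by blast
qed

lemma qadd_Zp: "x \<in> Zp p \<Longrightarrow> y \<in> Zp p \<Longrightarrow> qadd p x y \<in> Zp p"
  by (simp add: Zp_def qadd_Qp) (simp add: qadd_def)

lemma unif_cont_cadd: "unif_cont f \<Longrightarrow> unif_cont g \<Longrightarrow> unif_cont (cadd p f g)"
  by (rule unif_cont_binary[of f g]) (simp_all add: cadd_def unif_cont_Zp qadd_Zp, simp add: qadd_def)

lemma unif_cont_cmul: "unif_cont f \<Longrightarrow> unif_cont g \<Longrightarrow> unif_cont (cmul p f g)"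
  by (rule unif_cont_binary[of f g]) (simp_all add: cmul_def unif_cont_Zp qmul_Zp qmul_Zp_apply)

definition cconst :: "qp \<Rightarrow> qp \<Rightarrow> qp" where
  "cconst c = restrict (\<lambda>z. c) (Zp p)"

lemma unif_cont_cconst: "c \<in> Zp p \<Longrightarrow> unif_cont (cconst c)"
  by (auto simp: unif_cont_def cconst_def)

lemma unif_cont_cid: "unif_cont (cid p)"
  by (auto simp: unif_cont_def cid_def)

text \<open>The representative is deliberately not unique: truncated Newton series and products of
  representatives must qualify.\<close>

definition approx :: "(qp \<Rightarrow> qp) \<Rightarrow> nat \<Rightarrow> (nat \<Rightarrow> int) \<Rightarrow> bool" where
  "approx f J g \<longleftrightarrow> (\<forall>k. pcong p J (of_int (g k)) (f (qint p (int k)) J))"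

definition residues :: "(qp \<Rightarrow> qp) \<Rightarrow> nat \<Rightarrow> nat \<Rightarrow> int" where
  "residues f J k = \<lfloor>f (qint p (int k)) J\<rfloor>"

lemma approx_residues: "unif_cont f \<Longrightarrow> approx f J (residues f J)"
  unfolding approx_def residues_def
proof
  fix k assume "unif_cont f"
  then obtain a where "f (qint p (int k)) J = of_int a"
    using Zp_int[OF unif_cont_Zp[OF _ qint_Zp]] by blast
  then show "pcong p J (of_int \<lfloor>f (qint p (int k)) J\<rfloor>) (f (qint p (int k)) J)" by simp
qed

lemma approx_mono: "unif_cont f \<Longrightarrow> approx f J g \<Longrightarrow> I \<le> J \<Longrightarrow> approx f I g"
  unfolding approx_def
  by (blast intro: pcong_trans[OF pcong_mono] Qp_coh Zp_Qp unif_cont_Zp qint_Zp)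

lemma approx_cong: "approx f J g \<Longrightarrow> (\<And>k. int p ^ J dvd h k - g k) \<Longrightarrow> approx f J h"
  unfolding approx_def by (meson pcong_int_dvd pcong_trans)

lemma approx_unique: "approx f J g \<Longrightarrow> approx f J h \<Longrightarrow> int p ^ J dvd g k - h k"
  unfolding approx_def by (meson pcong_int_dvd pcong_sym pcong_trans)

lemma approx_mahler_cong:
  "approx f J g \<Longrightarrow> approx f J h \<Longrightarrow> int p ^ J dvd mahler g n - mahler h n"
  using mahler_dvd[of "int p ^ J" "\<lambda>k. g k - h k" n] approx_unique by (simp add: mahler_diff)

text \<open>Mahler's theorem modulo p^J. The numbers k and k + p^N agree at level \<open>N\<close>,
  so uniform continuity makes \<open>g\<close> periodic modulo p^J.\<close>

lemma mahler_eventually: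
  assumes f: "unif_cont f" and g: "approx f J g"
  shows "\<exists>N. \<forall>n\<ge>N. int p ^ J dvd mahler g n"
proof -
  obtain N where N: "\<forall>z \<in> Zp p. \<forall>w \<in> Zp p. z N = w N \<longrightarrow> f z J = f w J"
    using f unfolding unif_cont_def by blast
  have "int p ^ J dvd g (x + p ^ N) - g x" for x
  proof -
    have "qint p (int (x + p ^ N)) N = qint p (int x) N"
      unfolding qint_def rmod_eq_iff pcong_int_dvd by simp
    then have "f (qint p (int (x + p ^ N))) J = f (qint p (int x)) J" using N qint_Zp by blast
    then show ?thesis
      using g unfolding approx_def by (metis pcong_int_dvd pcong_sym pcong_trans)
  qed
  then have "\<And>n. n \<ge> J * p ^ N \<Longrightarrow> int p ^ J dvd mahler g n" by (rule mahler_periodic[OF prime_p])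
  then show ?thesis by blast
qed

lemma approx_ex:
  "unif_cont f \<Longrightarrow> \<exists>g N. approx f J g \<and> (\<forall>n\<ge>N. int p ^ J dvd mahler g n)"
  using approx_residues mahler_eventually by blast

lemma approx_cadd:
  assumes "approx f J g" "approx f' J g'"
  shows "approx (cadd p f f') J (\<lambda>k. g k + g' k)"
  unfolding approx_def
proof
  fix k
  have "pcong p J (of_int (g k) + of_int (g' k)) (f (qint p (int k)) J + f' (qint p (int k)) J)"
    using assms unfolding approx_def by (intro pcong_add) auto
  then show "pcong p J (of_int (g k + g' k)) (cadd p f f' (qint p (int k)) J)"
    by (simp add: cadd_def qadd_def) (meson pcong_rmod pcong_sym pcong_trans)
qed

lemma approx_cmul:
  assumes f: "unif_cont f" "unif_cont f'" and "approx f J g" "approx f' J g'"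
  shows "approx (cmul p f f') J (\<lambda>k. g k * g' k)"
  unfolding approx_def
proof
  fix k
  let ?z = "qint p (int k)"
  have Z: "f ?z \<in> Zp p" "f' ?z \<in> Zp p" using f by (auto intro: unif_cont_Zp)
  obtain b where b: "f' ?z J = of_int b" using Zp_int[OF Z(2)] by blast
  have 1: "pcong p J (of_int (g k) * of_int (g' k)) (of_int (g k) * f' ?z J)"
    using assms unfolding approx_def by (intro pcong_mult) auto
  have 2: "pcong p J (of_int b * of_int (g k)) (of_int b * f ?z J)"
    using assms unfolding approx_def by (intro pcong_mult) auto
  have "pcong p J (of_int (g k * g' k)) (f ?z J * f' ?z J)"
    using pcong_trans[OF 1, of "f ?z J * f' ?z J"] 2 by (simp add: b mult.commute)
  then show "pcong p J (of_int (g k * g' k)) (cmul p f f' ?z J)"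
    by (simp add: cmul_def qmul_Zp_apply Z) (meson pcong_rmod pcong_sym pcong_trans)
qed

lemma approx_cid: "approx (cid p) J int"
  unfolding approx_def
proof
  fix k
  have "pcong p J (of_int (int k)) (qint p (int k) J)"
    unfolding qint_def by (rule pcong_sym) simp
  then show "pcong p J (of_int (int k)) (cid p (qint p (int k)) J)" by (simp add: cid_def)
qed

lemma approx_cconst:
  "approx (cconst c) J (\<lambda>_. a) \<longleftrightarrow> pcong p J (of_int a) (c J)"
  unfolding approx_def cconst_def by simp

end

section \<open>The restricted product and its topology\<close>

locale vec_space = prime_base p for p :: nat +
  fixes X :: "'a set"
begin

definition denom_le :: "nat \<Rightarrow> 'a qvec \<Rightarrow> bool" where
  "denom_le d \<xi> \<longleftrightarrow> (\<forall>i\<in>X. \<exists>t. \<xi> i 0 * of_nat p ^ d = of_int t)"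

text \<open>Basic neighbourhoods of 0. Vanishing at level 0 on all of \<open>X\<close> confines them
  to the unit ball, on which \<tau> is the product topology.\<close>

definition nbh :: "'a set \<Rightarrow> nat \<Rightarrow> 'a qvec set" where
  "nbh F m = {\<xi> \<in> QpX p X. (\<forall>i\<in>X. \<xi> i 0 = 0) \<and> (\<forall>i\<in>F. \<xi> i m = 0)}"

lemma QpX_Qp: "\<xi> \<in> QpX p X \<Longrightarrow> i \<in> X \<Longrightarrow> \<xi> i \<in> Qp p"
  unfolding QpX_def by auto

lemma QpX_finite: "\<xi> \<in> QpX p X \<Longrightarrow> finite {i\<in>X. \<xi> i 0 \<noteq> 0}"
proof -
  assume \<xi>: "\<xi> \<in> QpX p X"
  have "{i\<in>X. \<xi> i 0 \<noteq> 0} = {i\<in>X. \<xi> i \<notin> Zp p}" using QpX_Qp[OF \<xi>] unfolding Zp_def by blast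
  then show ?thesis using \<xi> unfolding QpX_def by simp
qed

lemma QpX_I:
  assumes "\<xi> \<in> extensional X" "\<And>i. i \<in> X \<Longrightarrow> \<xi> i \<in> Qp p" "finite {i\<in>X. \<xi> i 0 \<noteq> 0}"
  shows "\<xi> \<in> QpX p X"
proof -
  have "{i\<in>X. \<xi> i 0 \<noteq> 0} = {i\<in>X. \<xi> i \<notin> Zp p}" using assms(2) unfolding Zp_def by blast
  then show ?thesis using assms unfolding QpX_def by (simp add: PiE_def)
qed

lemma QpX_eqI:
  assumes \<xi>: "\<xi> \<in> QpX p X" and \<eta>: "\<eta> \<in> QpX p X"
    and eq: "\<And>i m. i \<in> X \<Longrightarrow> pcong p m (\<xi> i m) (\<eta> i m)"
  shows "\<xi> = \<eta>"
proof (rule extensionalityI[of _ X])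
  show "\<xi> \<in> extensional X" "\<eta> \<in> extensional X" using \<xi> \<eta> unfolding QpX_def PiE_def by auto
  fix i assume i: "i \<in> X"
  show "\<xi> i = \<eta> i" using eq[OF i] Qp_eq_iff[OF QpX_Qp[OF \<xi> i] QpX_Qp[OF \<eta> i]] by blast
qed

lemma QpX_rmodI:
  assumes "\<And>i n. i \<in> X \<Longrightarrow> plike p (y i n)"
    and "\<And>i n. i \<in> X \<Longrightarrow> pcong p n (y i n) (y i (Suc n))"
    and "finite {i\<in>X. rmod p 0 (y i 0) \<noteq> 0}"
  shows "restrict (\<lambda>i n. rmod p n (y i n)) X \<in> QpX p X"
proof (rule QpX_I)
  have "{i\<in>X. restrict (\<lambda>i n. rmod p n (y i n)) X i 0 \<noteq> 0} = {i\<in>X. rmod p 0 (y i 0) \<noteq> 0}"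
    by auto
  then show "finite {i\<in>X. restrict (\<lambda>i n. rmod p n (y i n)) X i 0 \<noteq> 0}" using assms(3) by simp
next
  fix i assume "i \<in> X"
  then show "restrict (\<lambda>i n. rmod p n (y i n)) X i \<in> Qp p"
    using Qp_rmodI[of "y i"] assms(1,2) by simp
qed simp

definition vzero :: "'a qvec" where
  "vzero = restrict (\<lambda>_. qzero) X"

lemma vzero_QpX: "vzero \<in> QpX p X"
  unfolding vzero_def by (rule QpX_I) (auto simp: qzero_def[THEN fun_cong] cong: conj_cong)

lemma vadd_apply: "i \<in> X \<Longrightarrow> vadd p X \<xi> \<eta> i m = rmod p m (\<xi> i m + \<eta> i m)"
  by (simp add: vadd_def qadd_def)

lemma vsub_apply: "i \<in> X \<Longrightarrow> vsub p X \<xi> \<eta> i m = rmod p m (\<xi> i m - \<eta> i m)"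
  by (simp add: vsub_def qsub_apply)

lemma vscal_apply:
  "\<xi> \<in> QpX p X \<Longrightarrow> i \<in> X \<Longrightarrow> vscal p X (qint p c) \<xi> i m = rmod p m (of_int c * \<xi> i m)"
  by (simp add: vscal_def qmul_apply_int QpX_Qp)

lemma QpX_coh: "\<xi> \<in> QpX p X \<Longrightarrow> i \<in> X \<Longrightarrow> pcong p n (\<xi> i n) (\<xi> i (Suc n))"
  by (rule pcong_sym, rule Qp_coh) (auto simp: QpX_Qp)

lemma vadd_QpX:
  assumes "\<xi> \<in> QpX p X" "\<eta> \<in> QpX p X"
  shows "vadd p X \<xi> \<eta> \<in> QpX p X"
proof -
  have "finite {i\<in>X. rmod p 0 (\<xi> i 0 + \<eta> i 0) \<noteq> 0}"
    by (rule finite_subset[OF _ finite_UnI[OF QpX_finite[OF assms(1)] QpX_finite[OF assms(2)]]]) auto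
  then have "restrict (\<lambda>i n. rmod p n (\<xi> i n + \<eta> i n)) X \<in> QpX p X"
    using assms by (intro QpX_rmodI plike_add pcong_add Qp_plike QpX_Qp QpX_coh)
  then show ?thesis by (simp add: vadd_def qadd_def[abs_def])
qed

lemma vsub_QpX:
  assumes "\<xi> \<in> QpX p X" "\<eta> \<in> QpX p X"
  shows "vsub p X \<xi> \<eta> \<in> QpX p X"
proof (rule QpX_I)
  show "vsub p X \<xi> \<eta> \<in> extensional X" by (simp add: vsub_def)
  show "\<And>i. i \<in> X \<Longrightarrow> vsub p X \<xi> \<eta> i \<in> Qp p"
    using assms by (simp add: vsub_def qsub_Qp QpX_Qp)
  have "\<xi> i 0 \<noteq> 0 \<or> \<eta> i 0 \<noteq> 0" if "i \<in> X" "vsub p X \<xi> \<eta> i 0 \<noteq> 0" for i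
    using that by (auto simp: vsub_apply)
  then show "finite {i\<in>X. vsub p X \<xi> \<eta> i 0 \<noteq> 0}"
    by (intro finite_subset[OF _ finite_UnI[OF QpX_finite[OF assms(1)] QpX_finite[OF assms(2)]]]) auto
qed

lemma vscal_QpX:
  assumes \<xi>: "\<xi> \<in> QpX p X"
  shows "vscal p X (qint p c) \<xi> \<in> QpX p X"
proof (rule QpX_I)
  show "vscal p X (qint p c) \<xi> \<in> extensional X" by (simp add: vscal_def)
  fix i assume i: "i \<in> X"
  have "(\<lambda>n. rmod p n (of_int c * \<xi> i n)) \<in> Qp p"
    using \<xi> i by (intro Qp_rmodI plike_mult_int pcong_mult Qp_plike QpX_Qp QpX_coh)
  moreover have "vscal p X (qint p c) \<xi> i = (\<lambda>n. rmod p n (of_int c * \<xi> i n))"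
    using vscal_apply[OF \<xi> i] by blast
  ultimately show "vscal p X (qint p c) \<xi> i \<in> Qp p" by simp
next
  have "\<xi> i 0 \<noteq> 0" if "i \<in> X" "vscal p X (qint p c) \<xi> i 0 \<noteq> 0" for i
    using that by (auto simp: vscal_apply \<xi>)
  then show "finite {i\<in>X. vscal p X (qint p c) \<xi> i 0 \<noteq> 0}"
    by (intro finite_subset[OF _ QpX_finite[OF \<xi>]]) auto
qed

lemma vscal_vzero: "\<xi> \<in> QpX p X \<Longrightarrow> vscal p X (qint p 0) \<xi> = vzero"
  by (intro QpX_eqI vscal_QpX vzero_QpX) (simp_all add: vscal_apply, simp add: vzero_def qzero_def)

lemma vadd_vsub: "\<xi> \<in> QpX p X \<Longrightarrow> \<eta> \<in> QpX p X \<Longrightarrow> vadd p X \<xi> (vsub p X \<eta> \<xi>) = \<eta>"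
proof (intro QpX_eqI vadd_QpX vsub_QpX)
  fix i m assume i: "i \<in> X"
  have "pcong p m (\<xi> i m + rmod p m (\<eta> i m - \<xi> i m)) (\<xi> i m + (\<eta> i m - \<xi> i m))"
    by (intro pcong_add) auto
  then show "pcong p m (vadd p X \<xi> (vsub p X \<eta> \<xi>) i m) (\<eta> i m)"
    using pcong_trans[OF pcong_rmod] by (simp add: vadd_apply vsub_apply i)
qed

section \<open>Denominators and norms of vectors\<close>

lemma denom_le_ex: assumes \<xi>: "\<xi> \<in> QpX p X" shows "\<exists>d. denom_le d \<xi>"
proof -
  \<comment> \<open>Only finitely many entries are nonintegral; the sum of their exponents bounds
    each of them and makes sense for the empty set.\<close>
  define d where "d = (\<Sum>i\<in>{i\<in>X. \<xi> i 0 \<noteq> 0}. qden p (\<xi> i))"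
  have "\<exists>t. \<xi> i 0 * of_nat p ^ d = of_int t" if i: "i \<in> X" for i
  proof (cases "\<xi> i 0 = 0")
    case True
    then show ?thesis by (intro exI[of _ 0]) simp
  next
    case False
    then have le: "qden p (\<xi> i) \<le> d"
      unfolding d_def using QpX_finite[OF \<xi>] i by (intro member_le_sum) auto
    obtain t where t: "\<xi> i 0 * of_nat p ^ qden p (\<xi> i) = of_int t"
      using qden_spec[OF QpX_Qp[OF \<xi> i]] by blast
    have "\<xi> i 0 * of_nat p ^ d = (\<xi> i 0 * of_nat p ^ qden p (\<xi> i)) * of_nat p ^ (d - qden p (\<xi> i))"
      using le by (simp add: mult.assoc power_add[symmetric])
    also have "\<dots> = of_int (t * int p ^ (d - qden p (\<xi> i)))" unfolding t by simp
    finally show ?thesis by blast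
  qed
  then show ?thesis unfolding denom_le_def by blast
qed

lemma denom_le_mono: "denom_le d \<xi> \<Longrightarrow> d \<le> e \<Longrightarrow> denom_le e \<xi>"
  unfolding denom_le_def
proof
  fix i assume "\<forall>i\<in>X. \<exists>t. \<xi> i 0 * of_nat p ^ d = of_int t" "d \<le> e" "i \<in> X"
  then obtain t where "\<xi> i 0 * of_nat p ^ d = of_int t" by blast
  then have "\<xi> i 0 * of_nat p ^ d * of_nat p ^ (e - d) = of_int (t * int p ^ (e - d))" by simp
  then show "\<exists>t. \<xi> i 0 * of_nat p ^ e = of_int t"
    using \<open>d \<le> e\<close> by (metis mult.assoc power_add le_add_diff_inverse)
qed

lemma denom_le_level:
  "denom_le d \<xi> \<Longrightarrow> \<xi> \<in> QpX p X \<Longrightarrow> i \<in> X \<Longrightarrow> \<exists>t. \<xi> i n * of_nat p ^ d = of_int t"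
  unfolding denom_le_def using Qp_integral[OF QpX_Qp] by blast

lemma denom_le_qnorm:
  assumes \<xi>: "\<xi> \<in> QpX p X" "denom_le d \<xi>" and i: "i \<in> X"
  shows "qnorm p (\<xi> i) \<le> real p ^ d"
proof (cases "\<xi> i 0 = 0")
  case True
  then have "qnorm p (\<xi> i) \<le> 1" using Zp_le_1 QpX_Qp[OF \<xi>(1) i] unfolding Zp_def by blast
  then show ?thesis using p_gt_1 one_le_power[of "real p" d] by linarith
next
  case False
  then have "\<xi> i \<noteq> qzero" by (auto simp: qzero_def)
  moreover have "qden p (\<xi> i) \<le> d" using \<xi>(2) i qden_le unfolding denom_le_def by blast
  ultimately show ?thesis using False p_gt_1 by (simp add: qnorm_def power_increasing)
qed

lemma vnorm_le: "s \<ge> 0 \<Longrightarrow> (\<And>i. i \<in> X \<Longrightarrow> qnorm p (\<xi> i) \<le> s) \<Longrightarrow> vnorm p X \<xi> \<le> s"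
  unfolding vnorm_def by (rule cSup_least) auto

lemma qnorm_le_vnorm: "\<xi> \<in> QpX p X \<Longrightarrow> i \<in> X \<Longrightarrow> qnorm p (\<xi> i) \<le> vnorm p X \<xi>"
proof -
  assume \<xi>: "\<xi> \<in> QpX p X" and i: "i \<in> X"
  obtain d where "denom_le d \<xi>" using denom_le_ex[OF \<xi>] by blast
  then have "bdd_above (insert 0 ((\<lambda>i. qnorm p (\<xi> i)) ` X))"
    using denom_le_qnorm[OF \<xi>] by (auto intro!: bdd_aboveI2)
  then show ?thesis unfolding vnorm_def using i by (intro cSup_upper) auto
qed

lemma vnorm_le_1_iff: "\<xi> \<in> QpX p X \<Longrightarrow> vnorm p X \<xi> \<le> 1 \<longleftrightarrow> (\<forall>i\<in>X. \<xi> i 0 = 0)"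
proof -
  assume \<xi>: "\<xi> \<in> QpX p X"
  have "qnorm p (\<xi> i) \<le> 1 \<longleftrightarrow> \<xi> i 0 = 0" if "i \<in> X" for i
    using qnorm_le_iff[OF QpX_Qp[OF \<xi> that], of 0] by simp
  then show ?thesis using vnorm_le[of 1 \<xi>] qnorm_le_vnorm[OF \<xi>] by (meson order_trans zero_le_one)
qed

section \<open>Open sets and continuity at 0\<close>

lemma boxP_iff:
  "\<xi> \<in> boxP p X P \<longleftrightarrow> \<xi> \<in> X \<rightarrow>\<^sub>E Qp p \<and> (\<forall>i \<in> X - P. \<xi> i 0 = 0)"
  unfolding boxP_def Zp_def by auto

lemma boxP_QpX: "\<xi> \<in> boxP p X P \<Longrightarrow> finite P \<Longrightarrow> \<xi> \<in> QpX p X"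
proof (rule QpX_I)
  assume \<xi>: "\<xi> \<in> boxP p X P" and P: "finite P"
  show "finite {i\<in>X. \<xi> i 0 \<noteq> 0}"
    by (rule finite_subset[OF _ P]) (use \<xi> in \<open>auto simp: boxP_iff\<close>)
qed (auto simp: boxP_iff PiE_def)

lemma QpX_boxP: "\<xi> \<in> QpX p X \<Longrightarrow> (\<And>i. i \<in> X - P \<Longrightarrow> \<xi> i 0 = 0) \<Longrightarrow> \<xi> \<in> boxP p X P"
  unfolding boxP_iff QpX_def by blast

lemma close_level:
  assumes "\<eta> \<in> QpX p X" "\<xi> \<in> QpX p X" "i \<in> X"
    and "qnorm p (qsub p (\<eta> i) (\<xi> i)) < inverse (real p ^ m)" "n \<le> m"
  shows "\<eta> i n = \<xi> i n"
  using qnorm_qsub_less[OF QpX_Qp QpX_Qp] Qp_level_mono[OF QpX_Qp QpX_Qp] assms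
  by (meson le_SucI)

lemma nbh_open:
  assumes F: "finite F" "F \<subseteq> X"
  shows "tau_open p X (nbh F m)"
  unfolding tau_open_def prod_open_def
proof (intro conjI allI impI ballI)
  fix P \<xi> assume P: "finite P \<and> P \<subseteq> X" and \<xi>: "\<xi> \<in> nbh F m \<inter> boxP p X P"
  \<comment> \<open>Closeness is demanded on \<open>P\<close> too: the box allows nonintegral
    entries there, whereas off \<open>P\<close> integrality is automatic.\<close>
  have "\<eta> \<in> nbh F m \<inter> boxP p X P" if \<eta>: "\<eta> \<in> boxP p X P"
    and close: "\<forall>i\<in>F \<union> P. qnorm p (qsub p (\<eta> i) (\<xi> i)) < inverse (real p ^ m)" for \<eta>
  proof -
    have V: "\<eta> \<in> QpX p X" "\<xi> \<in> QpX p X" using boxP_QpX \<eta> \<xi> P by auto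
    have eq: "\<eta> i n = \<xi> i n" if "i \<in> F \<union> P" "n \<le> m" for i n
      using close_level[OF V] close that F P by blast
    have "\<eta> i 0 = 0" if "i \<in> X" for i
    proof (cases "i \<in> P")
      case True
      then show ?thesis using eq[of i 0] \<xi> that unfolding nbh_def by auto
    qed (use \<eta> that in \<open>auto simp: boxP_iff\<close>)
    moreover have "\<eta> i m = 0" if "i \<in> F" for i using eq[of i m] \<xi> that unfolding nbh_def by auto
    ultimately show ?thesis using V \<eta> unfolding nbh_def by blast
  qed
  moreover have "inverse (real p ^ m) > 0" by simp
  ultimately show "\<exists>F' \<epsilon>. finite F' \<and> F' \<subseteq> X \<and> 0 < \<epsilon> \<and> (\<forall>\<eta>\<in>boxP p X P.
      (\<forall>i\<in>F'. qnorm p (qsub p (\<eta> i) (\<xi> i)) < \<epsilon>) \<longrightarrow> \<eta> \<in> nbh F m \<inter> boxP p X P)"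
    using F P by (intro exI[of _ "F \<union> P"] exI[of _ "inverse (real p ^ m)"]) blast
qed (auto simp: nbh_def)

definition cont0 :: "('a qvec \<Rightarrow> 'a qvec) \<Rightarrow> bool" where
  "cont0 T \<longleftrightarrow> (\<forall>F m. finite F \<and> F \<subseteq> X \<longrightarrow>
     (\<exists>F' m'. finite F' \<and> F' \<subseteq> X \<and> (\<forall>\<xi> \<in> nbh F' m'. T \<xi> \<in> nbh F m)))"

lemma Bops_QpX: "T \<in> Bops p X \<Longrightarrow> \<xi> \<in> QpX p X \<Longrightarrow> T \<xi> \<in> QpX p X"
  unfolding Bops_def Zp_linear_def by blast

lemma Bops_vadd:
  "T \<in> Bops p X \<Longrightarrow> \<xi> \<in> QpX p X \<Longrightarrow> \<eta> \<in> QpX p X \<Longrightarrow> T (vadd p X \<xi> \<eta>) = vadd p X (T \<xi>) (T \<eta>)"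
  unfolding Bops_def Zp_linear_def by blast

lemma Bops_vscal:
  "T \<in> Bops p X \<Longrightarrow> \<xi> \<in> QpX p X \<Longrightarrow> T (vscal p X (qint p c) \<xi>) = vscal p X (qint p c) (T \<xi>)"
  unfolding Bops_def Zp_linear_def using qint_Zp by blast

lemma Bops_vzero: "T \<in> Bops p X \<Longrightarrow> T vzero = vzero"
  using Bops_vscal[OF _ vzero_QpX, of T 0] vscal_vzero[OF vzero_QpX]
    vscal_vzero[OF Bops_QpX[OF _ vzero_QpX], of T] by simp

lemma Bops_cont0:
  assumes T: "T \<in> Bops p X"
  shows "cont0 T"
  unfolding cont0_def
proof (intro allI impI)
  fix F m assume F: "finite F \<and> F \<subseteq> X"
  define Pre where "Pre = {\<xi> \<in> QpX p X. T \<xi> \<in> nbh F m}"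
  have "tau_open p X Pre"
    using T nbh_open[of F m] F unfolding Bops_def tau_continuous_def Pre_def by blast
  \<comment> \<open>The box for the empty set is the unit ball, so this instance already gives a
    product neighbourhood of 0.\<close>
  then have open0: "prod_open p X {} (Pre \<inter> boxP p X {})" unfolding tau_open_def by blast
  have "vzero \<in> nbh F m" unfolding nbh_def using vzero_QpX F by (auto simp: vzero_def qzero_def)
  then have "vzero \<in> Pre \<inter> boxP p X {}"
    unfolding Pre_def using Bops_vzero[OF T] vzero_QpX by (auto intro!: QpX_boxP simp: vzero_def qzero_def)
  then obtain F' \<epsilon> where F': "finite F'" "F' \<subseteq> X" and \<epsilon>: "\<epsilon> > 0"
    and close: "\<forall>\<eta>\<in>boxP p X {}. (\<forall>i\<in>F'. qnorm p (qsub p (\<eta> i) (vzero i)) < \<epsilon>) \<longrightarrow> \<eta> \<in> Pre \<inter> boxP p X {}"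
    using open0 unfolding prod_open_def by blast
  obtain m' where m': "inverse (real p ^ m') < \<epsilon>" using small_power[OF \<epsilon>] by blast
  have "T \<xi> \<in> nbh F m" if \<xi>: "\<xi> \<in> nbh F' m'" for \<xi>
  proof -
    have V: "\<xi> \<in> QpX p X" and box: "\<xi> \<in> boxP p X {}"
      using \<xi> unfolding nbh_def by (auto intro!: QpX_boxP)
    have "qnorm p (qsub p (\<xi> i) (vzero i)) < \<epsilon>" if i: "i \<in> F'" for i
    proof -
      have "\<xi> i m' = vzero i m'" using \<xi> i F'(2) by (auto simp: nbh_def vzero_def qzero_def)
      then have "qnorm p (qsub p (\<xi> i) (vzero i)) \<le> inverse (real p ^ m')"
        using qnorm_qsub_le_iff[OF QpX_Qp[OF V] QpX_Qp[OF vzero_QpX]] i F'(2) by blast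
      then show ?thesis using m' by linarith
    qed
    then have "\<xi> \<in> Pre" using close box by blast
    then show ?thesis unfolding Pre_def by blast
  qed
  then show "\<exists>F' m'. finite F' \<and> F' \<subseteq> X \<and> (\<forall>\<xi> \<in> nbh F' m'. T \<xi> \<in> nbh F m)"
    using F' by blast
qed

lemma cont0_tau_continuous:
  assumes TV: "\<And>\<xi>. \<xi> \<in> QpX p X \<Longrightarrow> T \<xi> \<in> QpX p X"
    and Tadd: "\<And>\<xi> \<eta>. \<xi> \<in> QpX p X \<Longrightarrow> \<eta> \<in> QpX p X \<Longrightarrow> T (vadd p X \<xi> \<eta>) = vadd p X (T \<xi>) (T \<eta>)"
    and T: "cont0 T"
  shows "tau_continuous p X T"
  unfolding tau_continuous_def
proof (intro allI impI)
  fix A assume A: "tau_open p X A"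
  define Pre where "Pre = {\<xi> \<in> QpX p X. T \<xi> \<in> A}"
  have "prod_open p X P (Pre \<inter> boxP p X P)" if P: "finite P" "P \<subseteq> X" for P
    unfolding prod_open_def
  proof (intro conjI ballI)
    fix \<xi> assume \<xi>: "\<xi> \<in> Pre \<inter> boxP p X P"
    then have V: "\<xi> \<in> QpX p X" and TA: "T \<xi> \<in> A" unfolding Pre_def by auto
    \<comment> \<open>The image may leave the box of \<xi>, so openness of \<open>A\<close> is
      tested in the box over the nonintegral coordinates of T \<xi>. A nearby \<eta> differs from
      \<xi> by an integral vector with integral image, so T \<eta> stays in that box.\<close>
    define Q where "Q = {i\<in>X. T \<xi> i 0 \<noteq> 0}"
    have Q: "finite Q" "Q \<subseteq> X" unfolding Q_def using QpX_finite[OF TV[OF V]] by auto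
    have "T \<xi> \<in> A \<inter> boxP p X Q"
      using TA TV[OF V] unfolding Q_def by (auto intro: QpX_boxP)
    moreover have "prod_open p X Q (A \<inter> boxP p X Q)" using A Q unfolding tau_open_def by blast
    ultimately obtain F \<epsilon> where F: "finite F" "F \<subseteq> X" and \<epsilon>: "\<epsilon> > 0"
      and close: "\<forall>\<eta>\<in>boxP p X Q. (\<forall>i\<in>F. qnorm p (qsub p (\<eta> i) (T \<xi> i)) < \<epsilon>) \<longrightarrow> \<eta> \<in> A \<inter> boxP p X Q"
      unfolding prod_open_def by blast
    obtain m where m: "inverse (real p ^ m) < \<epsilon>" using small_power[OF \<epsilon>] by blast
    obtain F' m' where F': "finite F'" "F' \<subseteq> X" and T': "\<forall>\<xi> \<in> nbh F' m'. T \<xi> \<in> nbh F m"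
      using T F unfolding cont0_def by meson
    have "\<eta> \<in> Pre \<inter> boxP p X P" if \<eta>: "\<eta> \<in> boxP p X P"
      and near: "\<forall>i\<in>F' \<union> P. qnorm p (qsub p (\<eta> i) (\<xi> i)) < inverse (real p ^ m')" for \<eta>
    proof -
      have V': "\<eta> \<in> QpX p X" using boxP_QpX \<eta> P by blast
      let ?w = "vsub p X \<eta> \<xi>"
      have w: "?w \<in> QpX p X" using V V' by (rule vsub_QpX[rotated])
      have eq: "\<eta> i n = \<xi> i n" if "i \<in> F' \<union> P" "n \<le> m'" for i n
        using close_level[OF V' V] near that F' P by blast
      have "?w i 0 = 0" if i: "i \<in> X" for i
      proof (cases "i \<in> P")
        case True
        then show ?thesis using eq[of i 0] i by (simp add: vsub_apply)
      next
        case False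
        then show ?thesis using \<eta> \<xi> i by (simp add: vsub_apply boxP_iff)
      qed
      moreover have "?w i m' = 0" if "i \<in> F'" for i
        using eq[of i m'] that F'(2) by (auto simp: vsub_apply)
      ultimately have "?w \<in> nbh F' m'" using w unfolding nbh_def by blast
      then have Tw: "T ?w \<in> nbh F m" using T' by blast
      have T\<eta>: "T \<eta> = vadd p X (T \<xi>) (T ?w)" using Tadd[OF V w] vadd_vsub[OF V V'] by simp
      have eq': "T \<eta> i n = T \<xi> i n" if "i \<in> X" "T ?w i n = 0" for i n
        using that QpX_Qp[OF TV[OF V]] by (simp add: T\<eta> vadd_apply)
      have "T \<eta> \<in> boxP p X Q"
      proof (rule QpX_boxP[OF TV[OF V']])
        fix i assume "i \<in> X - Q"
        then show "T \<eta> i 0 = 0" using eq'[of i 0] Tw unfolding Q_def nbh_def by auto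
      qed
      moreover have "qnorm p (qsub p (T \<eta> i) (T \<xi> i)) < \<epsilon>" if i: "i \<in> F" for i
      proof -
        have "T \<eta> i m = T \<xi> i m" using eq'[of i m] Tw i F(2) unfolding nbh_def by auto
        then have "qnorm p (qsub p (T \<eta> i) (T \<xi> i)) \<le> inverse (real p ^ m)"
          using qnorm_qsub_le_iff[OF QpX_Qp[OF TV[OF V']] QpX_Qp[OF TV[OF V]]] i F(2) by blast
        then show ?thesis using m by linarith
      qed
      ultimately have "T \<eta> \<in> A" using close by blast
      then show ?thesis using \<eta> V' unfolding Pre_def by blast
    qed
    moreover have "inverse (real p ^ m') > 0" by simp
    ultimately show "\<exists>F \<epsilon>. finite F \<and> F \<subseteq> X \<and> 0 < \<epsilon> \<and> (\<forall>\<eta>\<in>boxP p X P.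
        (\<forall>i\<in>F. qnorm p (qsub p (\<eta> i) (\<xi> i)) < \<epsilon>) \<longrightarrow> \<eta> \<in> Pre \<inter> boxP p X P)"
      using F' P by (intro exI[of _ "F' \<union> P"] exI[of _ "inverse (real p ^ m')"]) blast
  qed blast
  then show "tau_open p X {\<xi> \<in> QpX p X. T \<xi> \<in> A}"
    unfolding tau_open_def Pre_def by blast
qed

text \<open>Continuity at 0 is what makes the supremum in the operator norm a supremum of a bounded set.\<close>

lemma opnorm_le_1_integral:
  assumes T: "T \<in> Bops p X" and le: "opnorm p X T \<le> 1"
    and \<xi>: "\<xi> \<in> QpX p X" "\<forall>i\<in>X. \<xi> i 0 = 0"
  shows "\<forall>i\<in>X. T \<xi> i 0 = 0"
proof -
  obtain F' m' where F': "finite F'" "F' \<subseteq> X" and T': "\<forall>\<xi> \<in> nbh F' m'. T \<xi> \<in> nbh {} 0"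
    using Bops_cont0[OF T] unfolding cont0_def by (metis empty_subsetI finite.emptyI)
  have bound: "vnorm p X (T \<eta>) \<le> real p ^ m'" if \<eta>: "\<eta> \<in> QpX p X" "\<forall>i\<in>X. \<eta> i 0 = 0" for \<eta>
  proof -
    \<comment> \<open>Multiplication by p^m' carries the unit ball into \<open>nbh F' m'\<close>,
      whatever \<open>F'\<close> is. Hence \<open>T\<close> maps the unit ball to vectors with
      denominator at most p^m'.\<close>
    let ?s = "vscal p X (qint p (int p ^ m'))"
    have 0: "?s \<eta> i m = 0" if i: "i \<in> X" "m \<le> m'" for i m
    proof -
      obtain t where "\<eta> i m * of_nat p ^ 0 = of_int t"
        using Qp_integral[OF QpX_Qp[OF \<eta>(1) i(1)], of 0 0] \<eta>(2) i by auto
      then have "pcong p m (of_int (int p ^ m') * \<eta> i m) 0"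
        using i(2) by (intro pcong_dvd[where J = m' and d = 0]) auto
      then show ?thesis using i by (simp add: vscal_apply[OF \<eta>(1)] rmod_eq_0)
    qed
    have "?s \<eta> \<in> nbh F' m'" using 0 vscal_QpX[OF \<eta>(1)] F'(2) unfolding nbh_def by auto
    then have "?s (T \<eta>) \<in> nbh {} 0" using T' Bops_vscal[OF T \<eta>(1)] by metis
    then have "pcong p 0 (of_int (int p ^ m') * T \<eta> i 0) 0" if "i \<in> X" for i
      using that Bops_QpX[OF T \<eta>(1)] unfolding nbh_def by (auto simp: vscal_apply rmod_eq_0)
    then have "denom_le m' (T \<eta>)"
      unfolding denom_le_def pcong_def by (auto simp: mult.commute)
    then show ?thesis using denom_le_qnorm[OF Bops_QpX[OF T \<eta>(1)]] by (intro vnorm_le) auto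
  qed
  have "bdd_above (insert 0 {vnorm p X (T \<eta>) | \<eta>. \<eta> \<in> QpX p X \<and> vnorm p X \<eta> \<le> 1})"
    using bound by (auto intro!: bdd_aboveI[of _ "real p ^ m'"] simp: vnorm_le_1_iff)
  then have "vnorm p X (T \<xi>) \<le> opnorm p X T"
    unfolding opnorm_def using \<xi> by (intro cSup_upper) (auto simp: vnorm_le_1_iff)
  then show ?thesis using le vnorm_le_1_iff[OF Bops_QpX[OF T \<xi>(1)]] by linarith
qed

end

section \<open>Finite combinations of the binomial operators\<close>

context vec_space
begin

text \<open>\<open>Qp_torsion_free\<close> applied to each coordinate of the difference; this is
  what lets factorials be cancelled.\<close>

lemma QpX_torsion_free:
  assumes u: "u \<in> QpX p X" and v: "v \<in> QpX p X" and n: "n > 0"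
    and eq: "vscal p X (qint p (int n)) u = vscal p X (qint p (int n)) v"
  shows "u = v"
proof (rule QpX_eqI[OF u v])
  fix i m assume i: "i \<in> X"
  let ?w = "qsub p (u i) (v i)"
  have "pcong p k (of_int (int n) * ?w k) 0" for k
  proof -
    have "pcong p k (of_int (int n) * ?w k) (of_int (int n) * (u i k - v i k))"
      unfolding qsub_apply by (rule pcong_mult) simp
    also have "pcong p k (of_int (int n) * (u i k - v i k)) 0"
      unfolding right_diff_distrib pcong_diff_0 rmod_eq_iff[symmetric]
        vscal_apply[OF u i, symmetric] vscal_apply[OF v i, symmetric] eq ..
    finally show ?thesis .
  qed
  then have "?w m = 0" using Qp_torsion_free qsub_Qp QpX_Qp u v i n by blast
  then show "pcong p m (u i m) (v i m)" using qsub_eq_0 QpX_Qp u v i by simp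
qed

text \<open>Here \<xi> need not be a normalized vector: denominators are estimated on the raw sum of
  residues and then transferred to its reduction.\<close>

lemma denom_le_pcong:
  "denom_le d \<xi> \<Longrightarrow> (\<And>i. i \<in> X \<Longrightarrow> pcong p 0 (\<eta> i 0) (\<xi> i 0)) \<Longrightarrow> denom_le d \<eta>"
  unfolding denom_le_def using pcong_integral by blast

lemma denom_le_vadd:
  assumes "denom_le d \<xi>" "denom_le d \<eta>"
  shows "denom_le d (vadd p X \<xi> \<eta>)"
proof (rule denom_le_pcong)
  show "denom_le d (\<lambda>i m. \<xi> i m + \<eta> i m)"
    unfolding denom_le_def distrib_right
  proof
    fix i assume "i \<in> X"
    then obtain t u where "\<xi> i 0 * of_nat p ^ d = of_int t" "\<eta> i 0 * of_nat p ^ d = of_int u"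
      using assms unfolding denom_le_def by blast
    then show "\<exists>t. \<xi> i 0 * of_nat p ^ d + \<eta> i 0 * of_nat p ^ d = of_int t"
      by (metis of_int_add)
  qed
qed (simp add: vadd_apply)

end

section \<open>Operators that preserve the unit ball\<close>

locale integral_op = vec_space p X for p :: nat and X :: "'a set" +
  fixes T :: "'a qvec \<Rightarrow> 'a qvec"
  assumes Bops: "T \<in> Bops p X"
    and integral: "\<And>\<xi>. \<xi> \<in> QpX p X \<Longrightarrow> \<forall>i\<in>X. \<xi> i 0 = 0 \<Longrightarrow> \<forall>i\<in>X. T \<xi> i 0 = 0"
begin

text \<open>Scaling by p^d brings \<xi> into the unit ball, which \<open>T\<close>
  preserves.\<close>

lemma denom_le_op:
  assumes \<xi>: "\<xi> \<in> QpX p X" and d: "denom_le d \<xi>"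
  shows "denom_le d (T \<xi>)"
proof -
  let ?s = "vscal p X (qint p (int p ^ d))"
  have "\<forall>i\<in>X. ?s \<xi> i 0 = 0"
    using d unfolding denom_le_def
    by (auto simp: vscal_apply \<xi> rmod_eq_0 pcong_def mult.commute)
  then have "\<forall>i\<in>X. ?s (T \<xi>) i 0 = 0"
    using integral[OF vscal_QpX[OF \<xi>]] Bops_vscal[OF Bops \<xi>] by metis
  then show ?thesis
    unfolding denom_le_def by (auto simp: vscal_apply Bops_QpX[OF Bops \<xi>] rmod_eq_0 pcong_def mult.commute)
qed

text \<open>Two vectors that agree modulo p^m differ by p^m times an integral vector w, and T(p^m w)
  = p^m T w with T w integral.\<close>

lemma level_op:
  assumes \<xi>: "\<xi> \<in> QpX p X" and \<eta>: "\<eta> \<in> QpX p X" and eq: "\<And>i. i \<in> X \<Longrightarrow> \<xi> i m = \<eta> i m"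
    and i: "i \<in> X"
  shows "T \<xi> i m = T \<eta> i m"
proof -
  let ?u = "vsub p X \<xi> \<eta>"
  have u: "?u \<in> QpX p X" using \<xi> \<eta> by (rule vsub_QpX)
  have "\<forall>i\<in>X. \<exists>y \<in> Zp p. \<forall>n. pcong p n (of_int (int p ^ m) * y n) (?u i n)"
    using Qp_divide[OF QpX_Qp[OF u]] eq by (simp add: vsub_apply)
  then obtain y where y: "\<And>i. i \<in> X \<Longrightarrow> y i \<in> Zp p"
    "\<And>i n. i \<in> X \<Longrightarrow> pcong p n (of_int (int p ^ m) * y i n) (?u i n)"
    by metis
  define w where "w = restrict y X"
  have w: "w \<in> QpX p X" "\<forall>i\<in>X. w i 0 = 0"
    using y(1) unfolding w_def by (auto intro!: QpX_I simp: Zp_def cong: conj_cong)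
  have "vscal p X (qint p (int p ^ m)) w = ?u"
  proof (rule QpX_eqI[OF vscal_QpX[OF w(1)] u])
    fix i n assume i: "i \<in> X"
    show "pcong p n (vscal p X (qint p (int p ^ m)) w i n) (?u i n)"
      unfolding vscal_apply[OF w(1) i] by (rule pcong_trans[OF pcong_rmod]) (use y(2) i in \<open>simp add: w_def\<close>)
  qed
  then have \<xi>_eq: "\<xi> = vadd p X \<eta> (vscal p X (qint p (int p ^ m)) w)"
    using vadd_vsub[OF \<eta> \<xi>] by simp
  have Tw: "T w \<in> QpX p X" using Bops_QpX[OF Bops w(1)] .
  have T\<xi>: "T \<xi> = vadd p X (T \<eta>) (vscal p X (qint p (int p ^ m)) (T w))"
    unfolding \<xi>_eq by (simp only: Bops_vadd[OF Bops \<eta> vscal_QpX[OF w(1)]] Bops_vscal[OF Bops w(1)])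
  have "T w i 0 = 0" using integral[OF w] i by blast
  then have "T w i 0 * of_nat p ^ 0 = of_int 0" by simp
  then obtain t where "T w i m * of_nat p ^ 0 = of_int t" using Qp_integral[OF QpX_Qp[OF Tw i]] by blast
  then have "pcong p m (of_int (int p ^ m) * T w i m) 0" by (intro pcong_dvd[where J = m and d = 0]) auto
  then have "vscal p X (qint p (int p ^ m)) (T w) i m = 0" by (simp add: vscal_apply Tw i rmod_eq_0)
  then show ?thesis using QpX_Qp[OF Bops_QpX[OF Bops \<eta>] i] by (simp add: T\<xi> vadd_apply i)
qed

end

text \<open>One witness of normality is fixed for every n; torsion-freeness determines it on
  Q_p(X).\<close>

locale normal_op = vec_space p X for p :: nat and X :: "'a set" +
  fixes A :: "'a qvec \<Rightarrow> 'a qvec" and B :: "nat \<Rightarrow> 'a qvec \<Rightarrow> 'a qvec"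
  assumes A_Bops: "A \<in> Bops p X"
    and B_Bops: "\<And>n. B n \<in> Bops p X"
    and B_fact: "\<And>n \<xi>. \<xi> \<in> QpX p X \<Longrightarrow> vscal p X (qint p (int (fact n))) (B n \<xi>) = falling_op p X A n \<xi>"
    and B_opnorm: "\<And>n. opnorm p X (B n) \<le> 1"
begin

sublocale B: integral_op p X "B n" for n
  by unfold_locales (rule B_Bops, rule opnorm_le_1_integral[OF B_Bops B_opnorm])

lemmas A_QpX = Bops_QpX[OF A_Bops]
lemmas B_QpX = Bops_QpX[OF B_Bops]

lemma falling_op_QpX: "\<xi> \<in> QpX p X \<Longrightarrow> falling_op p X A n \<xi> \<in> QpX p X"
  by (induction n) (auto intro: vsub_QpX vscal_QpX A_QpX)

text \<open>With F = n! B n \<xi>, the recursion of \<open>falling_op\<close> reads (n + 1)! B (n +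
  1) \<xi> = A F - n F. Multiplying by n + 1 yields the claim times (n + 1)!, and that factor is
  cancelled.\<close>

lemma A_B:
  assumes \<xi>: "\<xi> \<in> QpX p X"
  shows "A (B n \<xi>) = vadd p X (vscal p X (qint p (int n)) (B n \<xi>)) (vscal p X (qint p (int (Suc n))) (B (Suc n) \<xi>))"
    (is "_ = ?v")
proof (rule QpX_torsion_free)
  let ?F = "falling_op p X A n \<xi>"
  show V: "A (B n \<xi>) \<in> QpX p X" "?v \<in> QpX p X"
    using \<xi> by (auto intro!: A_QpX B_QpX vadd_QpX vscal_QpX)
  show "(0::nat) < fact (Suc n)" by simp
  show "vscal p X (qint p (int (fact (Suc n)))) (A (B n \<xi>)) = vscal p X (qint p (int (fact (Suc n)))) ?v"
  proof (rule QpX_eqI[OF vscal_QpX[OF V(1)] vscal_QpX[OF V(2)]])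
    fix i m assume i: "i \<in> X"
    let ?a = "A (B n \<xi>) i m" and ?b = "B n \<xi> i m" and ?b' = "B (Suc n) \<xi> i m"
    let ?f = "?F i m" and ?f' = "falling_op p X A (Suc n) \<xi> i m" and ?af = "A ?F i m"
    have b: "pcong p m (of_int (int (fact n)) * ?b) ?f"
      using vscal_apply[OF B_QpX[OF \<xi>] i, of "int (fact n)" n m] unfolding B_fact[OF \<xi>]
      by (metis pcong_rmod pcong_sym)
    have b': "pcong p m (of_int (int (fact (Suc n))) * ?b') ?f'"
      using vscal_apply[OF B_QpX[OF \<xi>] i, of "int (fact (Suc n))" "Suc n" m] unfolding B_fact[OF \<xi>]
      by (metis pcong_rmod pcong_sym)
    have "A ?F = vscal p X (qint p (int (fact n))) (A (B n \<xi>))"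
      unfolding B_fact[OF \<xi>, symmetric] by (rule Bops_vscal[OF A_Bops B_QpX[OF \<xi>]])
    then have a: "pcong p m (of_int (int (fact n)) * ?a) ?af"
      using vscal_apply[OF A_QpX[OF B_QpX[OF \<xi>]] i, of "int (fact n)" n m]
      by (metis pcong_rmod pcong_sym)
    have "?f' = rmod p m (?af - rmod p m (of_int (int n) * ?f))"
      by (simp add: vsub_apply i vscal_apply falling_op_QpX \<xi>)
    then have "pcong p m ?f' (?af - rmod p m (of_int (int n) * ?f))" by simp
    also have "pcong p m (?af - rmod p m (of_int (int n) * ?f)) (?af - of_int (int n) * ?f)"
      by (intro pcong_diff) auto
    finally have f': "pcong p m ?f' (?af - of_int (int n) * ?f)" .
    have "pcong p m (of_int (int (Suc n)) * (of_int (int n) * (of_int (int (fact n)) * ?b) + of_int (int (fact (Suc n))) * ?b'))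
        (of_int (int (Suc n)) * (of_int (int n) * ?f + (?af - of_int (int n) * ?f)))"
      by (intro pcong_mult pcong_add b pcong_trans[OF b' f'])
    also have "of_int (int (Suc n)) * (of_int (int n) * ?f + (?af - of_int (int n) * ?f)) = of_int (int (Suc n)) * ?af"
      by simp
    also have "pcong p m (of_int (int (Suc n)) * ?af) (of_int (int (Suc n)) * (of_int (int (fact n)) * ?a))"
      by (intro pcong_mult pcong_sym[OF a])
    finally have *: "pcong p m (of_int (int (fact (Suc n))) * (of_int (int n) * ?b + of_int (int (Suc n)) * ?b'))
        (of_int (int (fact (Suc n))) * ?a)"
      by (simp add: algebra_simps)
    have "pcong p m (?v i m) (of_int (int n) * ?b + of_int (int (Suc n)) * ?b')"
      unfolding vadd_apply[OF i] vscal_apply[OF B_QpX[OF \<xi>] i]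
      by (rule pcong_trans[OF pcong_rmod pcong_add[OF pcong_rmod pcong_rmod]])
    then have "pcong p m (of_int (int (fact (Suc n))) * ?v i m) (of_int (int (fact (Suc n))) * ?a)"
      using * pcong_mult pcong_trans by blast
    then show "pcong p m (vscal p X (qint p (int (fact (Suc n)))) (A (B n \<xi>)) i m)
        (vscal p X (qint p (int (fact (Suc n)))) ?v i m)"
      unfolding vscal_apply[OF V(1) i] vscal_apply[OF V(2) i] by (simp only: rmod_eqI pcong_sym) simp
  qed
qed

text \<open>The operator attached to the integer-valued polynomial with Newton coefficients
  \<open>c n\<close>, n < \<open>N\<close>.\<close>

definition lin :: "(nat \<Rightarrow> int) \<Rightarrow> nat \<Rightarrow> 'a qvec \<Rightarrow> 'a qvec" where
  "lin c N \<xi> = restrict (\<lambda>i m. rmod p m (\<Sum>n<N. of_int (c n) * B n \<xi> i m)) X"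

lemma lin_apply: "i \<in> X \<Longrightarrow> lin c N \<xi> i m = rmod p m (\<Sum>n<N. of_int (c n) * B n \<xi> i m)"
  by (simp add: lin_def)

lemma lin_pcong: "i \<in> X \<Longrightarrow> pcong p m (lin c N \<xi> i m) (\<Sum>n<N. of_int (c n) * B n \<xi> i m)"
  by (simp add: lin_apply)

lemma lin_QpX:
  assumes \<xi>: "\<xi> \<in> QpX p X"
  shows "lin c N \<xi> \<in> QpX p X"
  unfolding lin_def
proof (rule QpX_rmodI)
  let ?y = "\<lambda>i m. \<Sum>n<N. of_int (c n) * B n \<xi> i m"
  have "\<exists>n<N. B n \<xi> i 0 \<noteq> 0" if "rmod p 0 (?y i 0) \<noteq> 0" for i
    by (rule ccontr) (use that in simp)
  then have "{i\<in>X. rmod p 0 (?y i 0) \<noteq> 0} \<subseteq> (\<Union>n<N. {i\<in>X. B n \<xi> i 0 \<noteq> 0})" by blast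
  then show "finite {i\<in>X. rmod p 0 (?y i 0) \<noteq> 0}"
    using QpX_finite[OF B_QpX[OF \<xi>]] by (auto elim!: finite_subset)
qed (intro plike_sum plike_mult_int pcong_sum pcong_mult Qp_plike QpX_coh QpX_Qp B_QpX \<xi>; assumption)+

lemma lin_Suc:
  assumes \<xi>: "\<xi> \<in> QpX p X"
  shows "lin c (Suc N) \<xi> = vadd p X (lin c N \<xi>) (vscal p X (qint p (c N)) (B N \<xi>))"
proof (intro QpX_eqI lin_QpX vadd_QpX vscal_QpX B_QpX \<xi>)
  fix i m assume i: "i \<in> X"
  have "pcong p m (lin c (Suc N) \<xi> i m) ((\<Sum>n<N. of_int (c n) * B n \<xi> i m) + of_int (c N) * B N \<xi> i m)"
    using lin_pcong[OF i, of m c "Suc N" \<xi>] by simp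
  also have "pcong p m \<dots> (lin c N \<xi> i m + vscal p X (qint p (c N)) (B N \<xi>) i m)"
    unfolding vscal_apply[OF B_QpX[OF \<xi>] i] lin_apply[OF i] by (intro pcong_add pcong_sym[OF pcong_rmod])
  also have "pcong p m \<dots> (vadd p X (lin c N \<xi>) (vscal p X (qint p (c N)) (B N \<xi>)) i m)"
    unfolding vadd_apply[OF i] by (rule pcong_sym) simp
  finally show "pcong p m (lin c (Suc N) \<xi> i m) (vadd p X (lin c N \<xi>) (vscal p X (qint p (c N)) (B N \<xi>)) i m)" .
qed

section \<open>From multiplication of polynomials to composition of operators\<close>

lemma op_lin:
  assumes T: "T \<in> Bops p X" and \<xi>: "\<xi> \<in> QpX p X" and i: "i \<in> X"
  shows "pcong p m (T (lin c N \<xi>) i m) (\<Sum>n<N. of_int (c n) * T (B n \<xi>) i m)"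
proof (induction N)
  case 0
  have "lin c 0 \<xi> = vzero"
    by (intro QpX_eqI lin_QpX vzero_QpX \<xi>) (simp add: lin_apply vzero_def qzero_def)
  then have "T (lin c 0 \<xi>) i m = 0" using Bops_vzero[OF T] i by (simp only:) (simp add: vzero_def qzero_def)
  then show ?case by simp
next
  case (Suc N)
  have "T (lin c (Suc N) \<xi>) = vadd p X (T (lin c N \<xi>)) (vscal p X (qint p (c N)) (T (B N \<xi>)))"
    unfolding lin_Suc[OF \<xi>]
    by (simp add: Bops_vadd[OF T] Bops_vscal[OF T] lin_QpX vscal_QpX B_QpX \<xi>)
  then have "T (lin c (Suc N) \<xi>) i m = rmod p m (T (lin c N \<xi>) i m + rmod p m (of_int (c N) * T (B N \<xi>) i m))"
    by (simp add: vadd_apply vscal_apply Bops_QpX[OF T] B_QpX \<xi> i)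
  also have "pcong p m \<dots> ((\<Sum>n<N. of_int (c n) * T (B n \<xi>) i m) + of_int (c N) * T (B N \<xi>) i m)"
    by (rule pcong_trans[OF pcong_rmod pcong_add[OF Suc.IH pcong_rmod]])
  finally show ?case by simp
qed

text \<open>The hypothesis says that \<open>g\<close> is a polynomial of degree below
  \<open>N\<close>; multiplication by x raises the bound to Suc N. Both sides are regrouped by
  \<open>mahler_mult_id\<close> and \<open>A_B\<close>.\<close>

lemma lin_mult_id:
  assumes \<xi>: "\<xi> \<in> QpX p X" and g: "\<And>n. n \<ge> N \<Longrightarrow> mahler g n = 0"
  shows "lin (mahler (\<lambda>k. int k * g k)) (Suc N) \<xi> = A (lin (mahler g) N \<xi>)"
proof (intro QpX_eqI lin_QpX A_QpX \<xi>)
  fix i m assume i: "i \<in> X"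
  let ?y = "\<lambda>n. B n \<xi> i m" and ?b = "\<lambda>n. of_int (mahler g n) :: rat"
  have "(\<Sum>n<Suc N. of_int (mahler (\<lambda>k. int k * g k) n) * ?y n) =
      (\<Sum>n<Suc N. ?b n * (of_nat n * ?y n)) + (\<Sum>n<Suc N. of_nat n * ?b (n - 1) * ?y n)"
    unfolding mahler_mult_id sum.distrib[symmetric] by (rule sum.cong) (auto simp: algebra_simps)
  also have "(\<Sum>n<Suc N. ?b n * (of_nat n * ?y n)) = (\<Sum>n<N. ?b n * (of_nat n * ?y n))"
    using g[of N] by simp
  \<comment> \<open>Reindexing by one: the term of index 0 carries the factor 0, so
    \<open>n - 1\<close> is never evaluated there with effect.\<close>
  also have "(\<Sum>n<Suc N. of_nat n * ?b (n - 1) * ?y n) = (\<Sum>n<N. ?b n * (of_nat (Suc n) * ?y (Suc n)))"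
    by (subst sum.lessThan_Suc_shift) (simp add: ac_simps)
  also have "(\<Sum>n<N. ?b n * (of_nat n * ?y n)) + \<dots> = (\<Sum>n<N. ?b n * (of_int (int n) * ?y n + of_int (int (Suc n)) * ?y (Suc n)))"
    unfolding sum.distrib[symmetric] distrib_left[symmetric] by simp
  finally have eq: "(\<Sum>n<Suc N. of_int (mahler (\<lambda>k. int k * g k) n) * ?y n) = \<dots>" .
  have "pcong p m (A (B n \<xi>) i m) (of_int (int n) * ?y n + of_int (int (Suc n)) * ?y (Suc n))" for n
    unfolding A_B[OF \<xi>] vadd_apply[OF i] vscal_apply[OF B_QpX[OF \<xi>] i]
    by (rule pcong_trans[OF pcong_rmod pcong_add[OF pcong_rmod pcong_rmod]])
  then have "pcong p m (\<Sum>n<N. ?b n * A (B n \<xi>) i m) (\<Sum>n<Suc N. of_int (mahler (\<lambda>k. int k * g k) n) * ?y n)"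
    unfolding eq by (intro pcong_sum pcong_mult)
  then show "pcong p m (lin (mahler (\<lambda>k. int k * g k)) (Suc N) \<xi> i m) (A (lin (mahler g) N \<xi>) i m)"
    using lin_pcong[OF i] op_lin[OF A_Bops \<xi> i] pcong_sym pcong_trans by meson
qed

text \<open>The degree bound and the operator identity go through one induction, since
  \<open>lin_mult_id\<close> needs the bound at every step.\<close>

lemma lin_falling:
  assumes \<xi>: "\<xi> \<in> QpX p X" and g: "\<And>n. n \<ge> N \<Longrightarrow> mahler g n = 0"
  shows "(\<forall>n \<ge> N + k. mahler (\<lambda>x. falling k x * g x) n = 0) \<and>
    lin (mahler (\<lambda>x. falling k x * g x)) (N + k) \<xi> = falling_op p X A k (lin (mahler g) N \<xi>)"
proof (induction k)
  case (Suc k)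
  let ?h = "\<lambda>x. falling k x * g x" and ?u = "falling_op p X A k (lin (mahler g) N \<xi>)"
  have h: "mahler ?h n = 0" if "n \<ge> N + k" for n using Suc.IH that by blast
  have u: "lin (mahler ?h) (N + k) \<xi> = ?u" using Suc.IH by blast
  have uV: "?u \<in> QpX p X" using falling_op_QpX lin_QpX \<xi> by blast
  have "(\<lambda>x. falling (Suc k) x * g x) = (\<lambda>x. int x * ?h x - int k * ?h x)"
    by (simp add: algebra_simps)
  then have eq: "mahler (\<lambda>x. falling (Suc k) x * g x) n = mahler (\<lambda>x. int x * ?h x) n - int k * mahler ?h n" for n
    by (simp only: mahler_diff mahler_mult)
  have "lin (mahler (\<lambda>x. falling (Suc k) x * g x)) (N + Suc k) \<xi> = vsub p X (A ?u) (vscal p X (qint p (int k)) ?u)"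
  proof (intro QpX_eqI lin_QpX vsub_QpX A_QpX vscal_QpX uV \<xi>)
    fix i m assume i: "i \<in> X"
    have "pcong p m (lin (mahler (\<lambda>x. falling (Suc k) x * g x)) (N + Suc k) \<xi> i m)
        ((\<Sum>n<Suc (N + k). of_int (mahler (\<lambda>x. int x * ?h x) n) * B n \<xi> i m)
         - of_int (int k) * (\<Sum>n<Suc (N + k). of_int (mahler ?h n) * B n \<xi> i m))"
      using lin_pcong[OF i, of m "mahler (\<lambda>x. falling (Suc k) x * g x)" "N + Suc k" \<xi>] unfolding eq
      by (simp only: sum_distrib_left sum_subtractf[symmetric] of_int_diff of_int_mult left_diff_distrib mult.assoc add_Suc_right)
    also have "(\<Sum>n<Suc (N + k). of_int (mahler ?h n) * B n \<xi> i m) = (\<Sum>n<N + k. of_int (mahler ?h n) * B n \<xi> i m)"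
      using h[of "N + k"] by simp
    also have "pcong p m ((\<Sum>n<Suc (N + k). of_int (mahler (\<lambda>x. int x * ?h x) n) * B n \<xi> i m)
         - of_int (int k) * (\<Sum>n<N + k. of_int (mahler ?h n) * B n \<xi> i m))
        (lin (mahler (\<lambda>x. int x * ?h x)) (Suc (N + k)) \<xi> i m - of_int (int k) * lin (mahler ?h) (N + k) \<xi> i m)"
      by (intro pcong_diff pcong_mult pcong_sym[OF lin_pcong[OF i]])
    also have "lin (mahler (\<lambda>x. int x * ?h x)) (Suc (N + k)) \<xi> = A ?u"
      using lin_mult_id[OF \<xi> h] u by simp
    also have "lin (mahler ?h) (N + k) \<xi> = ?u" by (rule u)
    also have "pcong p m (A ?u i m - of_int (int k) * ?u i m) (vsub p X (A ?u) (vscal p X (qint p (int k)) ?u) i m)"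
      unfolding vsub_apply[OF i] vscal_apply[OF uV i]
      by (rule pcong_sym, rule pcong_trans[OF pcong_rmod pcong_diff[OF pcong_refl pcong_rmod]])
    finally show "pcong p m (lin (mahler (\<lambda>x. falling (Suc k) x * g x)) (N + Suc k) \<xi> i m)
        (vsub p X (A ?u) (vscal p X (qint p (int k)) ?u) i m)" .
  qed
  moreover have "mahler (\<lambda>x. falling (Suc k) x * g x) n = 0" if "n \<ge> N + Suc k" for n
    unfolding eq mahler_mult_id using h[of n] h[of "n - 1"] that by simp
  ultimately show ?case by simp
qed (use g in simp)

text \<open>\<open>falling_eq\<close> turns \<open>lin_falling\<close> into k! times the claim; k!
  is cancelled in the integers for the bound and in Q_p(X) for the operators.\<close>

lemma lin_binomial:
  assumes \<xi>: "\<xi> \<in> QpX p X" and g: "\<And>n. n \<ge> N \<Longrightarrow> mahler g n = 0"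
  shows "\<And>n. n \<ge> N + k \<Longrightarrow> mahler (\<lambda>x. int (x choose k) * g x) n = 0"
    and "lin (mahler (\<lambda>x. int (x choose k) * g x)) (N + k) \<xi> = B k (lin (mahler g) N \<xi>)"
proof -
  let ?h = "\<lambda>x. int (x choose k) * g x"
  have "(\<lambda>x. falling k x * g x) = (\<lambda>x. int (fact k) * ?h x)"
    by (simp add: falling_eq mult.assoc)
  then have eq: "mahler (\<lambda>x. falling k x * g x) n = int (fact k) * mahler ?h n" for n
    by (simp only: mahler_mult)
  have falling: "\<forall>n \<ge> N + k. mahler (\<lambda>x. falling k x * g x) n = 0"
    "lin (mahler (\<lambda>x. falling k x * g x)) (N + k) \<xi> = falling_op p X A k (lin (mahler g) N \<xi>)"
    using lin_falling[where g = g and N = N and k = k, OF \<xi> g] by simp_all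
  show "mahler ?h n = 0" if "n \<ge> N + k" for n
  proof -
    have "mahler (\<lambda>x. falling k x * g x) n = 0" using falling that by blast
    then show ?thesis unfolding eq by simp
  qed
  show "lin (mahler ?h) (N + k) \<xi> = B k (lin (mahler g) N \<xi>)"
  proof (rule QpX_torsion_free)
    show V: "lin (mahler ?h) (N + k) \<xi> \<in> QpX p X" "B k (lin (mahler g) N \<xi>) \<in> QpX p X"
      using lin_QpX B_QpX \<xi> by auto
    show "(0::nat) < fact k" by simp
    have "vscal p X (qint p (int (fact k))) (lin (mahler ?h) (N + k) \<xi>)
        = lin (mahler (\<lambda>x. falling k x * g x)) (N + k) \<xi>"
    proof (rule QpX_eqI[OF vscal_QpX[OF V(1)] lin_QpX[OF \<xi>]])
      fix i m assume i: "i \<in> X"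
      have "pcong p m (vscal p X (qint p (int (fact k))) (lin (mahler ?h) (N + k) \<xi>) i m)
          (of_int (int (fact k)) * (\<Sum>n<N + k. of_int (mahler ?h n) * B n \<xi> i m))"
        unfolding vscal_apply[OF V(1) i]
        by (rule pcong_trans[OF pcong_rmod pcong_mult[OF lin_pcong[OF i]]])
      also have "of_int (int (fact k)) * (\<Sum>n<N + k. of_int (mahler ?h n) * B n \<xi> i m)
          = (\<Sum>n<N + k. of_int (mahler (\<lambda>x. falling k x * g x) n) * B n \<xi> i m)"
        unfolding eq by (simp only: sum_distrib_left of_int_mult mult.assoc)
      also have "pcong p m \<dots> (lin (mahler (\<lambda>x. falling k x * g x)) (N + k) \<xi> i m)"
        by (rule pcong_sym[OF lin_pcong[OF i]])
      finally show "pcong p m (vscal p X (qint p (int (fact k))) (lin (mahler ?h) (N + k) \<xi>) i m)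
          (lin (mahler (\<lambda>x. falling k x * g x)) (N + k) \<xi> i m)" .
    qed
    also have "\<dots> = falling_op p X A k (lin (mahler g) N \<xi>)" by (rule falling(2))
    also have "\<dots> = vscal p X (qint p (int (fact k))) (B k (lin (mahler g) N \<xi>))"
      using B_fact[OF lin_QpX[OF \<xi>]] by simp
    finally show "vscal p X (qint p (int (fact k))) (lin (mahler ?h) (N + k) \<xi>) =
        vscal p X (qint p (int (fact k))) (B k (lin (mahler g) N \<xi>))" .
  qed
qed

text \<open>Expand the first factor into binomial polynomials and apply \<open>lin_binomial\<close>
  to each. The coefficients of \<open>f\<close> itself appear on the right because truncation leaves
  those below \<open>N\<close> unchanged.\<close>

lemma lin_mtrunc_mult:
  assumes \<xi>: "\<xi> \<in> QpX p X" and g: "\<And>n. n \<ge> M \<Longrightarrow> mahler g n = 0"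
  shows "\<And>n. n \<ge> M + N \<Longrightarrow> mahler (\<lambda>x. mtrunc N f x * g x) n = 0"
    and "lin (mahler (\<lambda>x. mtrunc N f x * g x)) (M + N) \<xi> = lin (mahler f) N (lin (mahler g) M \<xi>)"
proof -
  let ?h = "\<lambda>k x. int (x choose k) * g x"
  have h: "mahler (?h k) n = 0" if "n \<ge> M + k" for k n using lin_binomial(1)[OF \<xi> g that] .
  have "(\<lambda>x. mtrunc N f x * g x) = (\<lambda>x. \<Sum>k<N. mahler f k * ?h k x)"
    by (simp add: mtrunc_def sum_distrib_right mult.assoc)
  then have eq: "mahler (\<lambda>x. mtrunc N f x * g x) n = (\<Sum>k<N. mahler f k * mahler (?h k) n)" for n
    by (simp only: mahler_sum finite_lessThan mahler_mult)
  show "mahler (\<lambda>x. mtrunc N f x * g x) n = 0" if "n \<ge> M + N" for n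
    unfolding eq
  proof (intro sum.neutral ballI)
    fix k assume "k \<in> {..<N}"
    then have "mahler (?h k) n = 0" using that by (intro h) simp
    then show "mahler f k * mahler (?h k) n = 0" by simp
  qed
  show "lin (mahler (\<lambda>x. mtrunc N f x * g x)) (M + N) \<xi> = lin (mahler f) N (lin (mahler g) M \<xi>)"
  proof (intro QpX_eqI lin_QpX \<xi>)
    fix i m assume i: "i \<in> X"
    have "(\<Sum>n<M + N. of_int (mahler (\<lambda>x. mtrunc N f x * g x) n) * B n \<xi> i m)
        = (\<Sum>n<M + N. \<Sum>k<N. of_int (mahler f k) * (of_int (mahler (?h k) n) * B n \<xi> i m))"
      unfolding eq by (simp only: of_int_sum of_int_mult sum_distrib_right mult.assoc)
    also have "\<dots> = (\<Sum>k<N. of_int (mahler f k) * (\<Sum>n<M + N. of_int (mahler (?h k) n) * B n \<xi> i m))"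
      unfolding sum_distrib_left by (rule sum.swap)
    \<comment> \<open>The inner range is cut from M + N to M + k, the length used in
      \<open>lin_binomial\<close>; the dropped coefficients are 0.\<close>
    also have "\<dots> = (\<Sum>k<N. of_int (mahler f k) * (\<Sum>n<M + k. of_int (mahler (?h k) n) * B n \<xi> i m))"
    proof (rule sum.cong)
      fix k assume "k \<in> {..<N}"
      then have "(\<Sum>n<M + N. of_int (mahler (?h k) n) * B n \<xi> i m)
          = (\<Sum>n<M + k. of_int (mahler (?h k) n) * B n \<xi> i m)"
        by (intro sum.mono_neutral_right) (auto simp: h)
      then show "of_int (mahler f k) * (\<Sum>n<M + N. of_int (mahler (?h k) n) * B n \<xi> i m)
          = of_int (mahler f k) * (\<Sum>n<M + k. of_int (mahler (?h k) n) * B n \<xi> i m)" by simp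
    qed simp
    finally have eq_sum: "(\<Sum>n<M + N. of_int (mahler (\<lambda>x. mtrunc N f x * g x) n) * B n \<xi> i m)
        = (\<Sum>k<N. of_int (mahler f k) * (\<Sum>n<M + k. of_int (mahler (?h k) n) * B n \<xi> i m))" .
    have "pcong p m (lin (mahler (\<lambda>x. mtrunc N f x * g x)) (M + N) \<xi> i m)
        (\<Sum>k<N. of_int (mahler f k) * (\<Sum>n<M + k. of_int (mahler (?h k) n) * B n \<xi> i m))"
      unfolding eq_sum[symmetric] by (rule lin_pcong[OF i])
    also have "pcong p m \<dots> (\<Sum>k<N. of_int (mahler f k) * B k (lin (mahler g) M \<xi>) i m)"
    proof (intro pcong_sum pcong_mult)
      fix k
      have eq: "lin (mahler (?h k)) (M + k) \<xi> = B k (lin (mahler g) M \<xi>)"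
        by (rule lin_binomial(2)) (rule \<xi>, erule g)
      show "pcong p m (\<Sum>n<M + k. of_int (mahler (?h k) n) * B n \<xi> i m) (B k (lin (mahler g) M \<xi>) i m)"
        unfolding eq[symmetric] by (rule pcong_sym[OF lin_pcong[OF i]])
    qed
    also have "pcong p m \<dots> (lin (mahler f) N (lin (mahler g) M \<xi>) i m)"
      by (rule pcong_sym[OF lin_pcong[OF i]])
    finally show "pcong p m (lin (mahler (\<lambda>x. mtrunc N f x * g x)) (M + N) \<xi> i m)
        (lin (mahler f) N (lin (mahler g) M \<xi>) i m)" .
  qed
qed

section \<open>The continuous functional calculus\<close>

text \<open>\<open>calculus\<close> needs one exponent per vector. The least one lies below every
  other bound, so a computation with a larger bound has enough precision to be compared with
  it.\<close>

definition denom :: "'a qvec \<Rightarrow> nat" where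
  "denom \<xi> = (LEAST d. denom_le d \<xi>)"

lemma denom_le_denom: "\<xi> \<in> QpX p X \<Longrightarrow> denom_le (denom \<xi>) \<xi>"
  unfolding denom_def using denom_le_ex by (rule LeastI_ex)

lemma denom_least: "denom_le d \<xi> \<Longrightarrow> denom \<xi> \<le> d"
  unfolding denom_def by (rule Least_le)

definition mbound :: "(qp \<Rightarrow> qp) \<Rightarrow> nat \<Rightarrow> nat" where
  "mbound f J = (SOME N. \<forall>n\<ge>N. int p ^ J dvd mahler (residues f J) n)"

lemma mbound: "unif_cont f \<Longrightarrow> n \<ge> mbound f J \<Longrightarrow> int p ^ J dvd mahler (residues f J) n"
proof -
  assume f: "unif_cont f" and n: "n \<ge> mbound f J"
  show ?thesis
    using someI_ex[OF mahler_eventually[OF f approx_residues[OF f, of J]]] n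
    unfolding mbound_def[symmetric] by blast
qed

text \<open>The Mahler series of \<open>f\<close> at \<open>A\<close>. If \<open>p\<^bsup>d\<^esup> \<xi>\<close> is integral then so is \<open>p\<^bsup>d\<^esup> B n \<xi>\<close>, and the residue
  of the sum modulo \<open>p\<^bsup>m\<^esup>\<close> only depends on the Mahler coefficients modulo \<open>p\<^bsup>m + d\<^esup>\<close>.\<close>

definition calculus :: "(qp \<Rightarrow> qp) \<Rightarrow> 'a qvec \<Rightarrow> 'a qvec" where
  "calculus f \<xi> = restrict (\<lambda>i m. let J = m + denom \<xi> in
     lin (mahler (residues f J)) (mbound f J) \<xi> i m) X"

lemma sum_truncate:
  fixes N M :: nat
  assumes y: "\<And>n. \<exists>t. y n * of_nat p ^ d = of_int t" and J: "m + d \<le> J"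
    and c: "\<And>n. n \<ge> N \<Longrightarrow> int p ^ J dvd c n" and M: "N \<le> M"
  shows "pcong p m (\<Sum>n<M. of_int (c n) * y n) (\<Sum>n<N. of_int (c n) * y n)"
proof -
  have "pcong p m (\<Sum>n<M. of_int (c n) * y n) (\<Sum>n<M. if n < N then of_int (c n) * y n else 0)"
  proof (rule pcong_sum)
    fix n
    obtain t where t: "y n * of_nat p ^ d = of_int t" using y by blast
    have "pcong p m (of_int (c n) * y n) 0" if "\<not> n < N"
      using that by (intro pcong_dvd[OF c J t]) simp
    then show "pcong p m (of_int (c n) * y n) (if n < N then of_int (c n) * y n else 0)" by simp
  qed
  also have "(\<Sum>n<M. if n < N then of_int (c n) * y n else 0) = (\<Sum>n<N. of_int (c n) * y n)"
    using M by (intro sum.mono_neutral_cong_right) auto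
  finally show ?thesis .
qed

text \<open>Independence of all choices: denominator bound, precision, representative and cutoff.
  Extend the defining sum to the larger cutoff, exchange coefficients congruent modulo p^I, then cut
  back to \<open>N\<close>; each change is invisible modulo p^m.\<close>

lemma calculus_eq_lin:
  assumes f: "unif_cont f" and \<xi>: "\<xi> \<in> QpX p X" and d: "denom_le d \<xi>" and J: "m + d \<le> J"
    and g: "approx f J g" and N: "\<And>n. n \<ge> N \<Longrightarrow> int p ^ J dvd mahler g n" and i: "i \<in> X"
  shows "calculus f \<xi> i m = lin (mahler g) N \<xi> i m"
proof -
  define e where "e = denom \<xi>"
  define I where "I = m + e"
  define h where "h = residues f I"
  define M where "M = mbound f I"
  define K where "K = max M N"
  let ?y = "\<lambda>n. B n \<xi> i m"
  have I: "I \<le> J" using denom_least[OF d] J by (simp add: I_def e_def)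
  have y: "\<exists>t. ?y n * of_nat p ^ e = of_int t" for n
    using denom_le_level[OF B.denom_le_op[OF \<xi> denom_le_denom[OF \<xi>]] B_QpX[OF \<xi>] i]
    unfolding e_def by blast
  have "pcong p m (\<Sum>n<M. of_int (mahler h n) * ?y n) (\<Sum>n<K. of_int (mahler h n) * ?y n)"
    using mbound[OF f, of I] unfolding h_def M_def K_def
    by (intro pcong_sym[OF sum_truncate[OF y, of m I]]) (auto simp: I_def)
  also have "pcong p m \<dots> (\<Sum>n<K. of_int (mahler g n) * ?y n)"
  proof (rule pcong_sum)
    fix n
    obtain t where t: "?y n * of_nat p ^ e = of_int t" using y by blast
    have "int p ^ I dvd mahler h n - mahler g n"
      unfolding h_def by (rule approx_mahler_cong[OF approx_residues[OF f] approx_mono[OF f g I]])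
    then have "pcong p m (of_int (mahler h n - mahler g n) * ?y n) 0"
      by (rule pcong_dvd[OF _ _ t]) (simp add: I_def)
    then show "pcong p m (of_int (mahler h n) * ?y n) (of_int (mahler g n) * ?y n)"
      by (simp add: left_diff_distrib pcong_diff_0)
  qed
  also have "pcong p m \<dots> (\<Sum>n<N. of_int (mahler g n) * ?y n)"
  proof (rule sum_truncate[OF y, of m I])
    show "int p ^ I dvd mahler g n" if "n \<ge> N" for n
      using N[OF that] I by (meson dvd_trans le_imp_power_dvd)
  qed (auto simp: I_def K_def)
  finally show ?thesis
    using i unfolding calculus_def by (simp add: Let_def lin_apply rmod_eq_iff e_def I_def h_def M_def)
qed

text \<open>Precision K + d serves all coordinates and all levels up to \<open>K\<close> at once, so
  finitely many levels of \<open>calculus\<close> inherit the properties of a single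
  \<open>lin\<close>.\<close>

lemma calculus_lin:
  assumes f: "unif_cont f" and \<xi>: "\<xi> \<in> QpX p X" and d: "denom_le d \<xi>"
  shows "\<exists>c N. \<forall>i\<in>X. \<forall>m\<le>K. calculus f \<xi> i m = lin c N \<xi> i m"
proof -
  obtain g N where g: "approx f (K + d) g" and N: "\<And>n. n \<ge> N \<Longrightarrow> int p ^ (K + d) dvd mahler g n"
    using approx_ex[OF f] by blast
  have "calculus f \<xi> i m = lin (mahler g) N \<xi> i m" if "i \<in> X" "m \<le> K" for i m
    using that(2) by (intro calculus_eq_lin[OF f \<xi> d _ g N that(1)]) simp_all
  then show ?thesis by blast
qed

lemma calculus_QpX:
  assumes f: "unif_cont f" and \<xi>: "\<xi> \<in> QpX p X"
  shows "calculus f \<xi> \<in> QpX p X"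
proof (rule QpX_I)
  obtain d where d: "denom_le d \<xi>" using denom_le_ex[OF \<xi>] by blast
  show "calculus f \<xi> \<in> extensional X" by (simp add: calculus_def)
  show "calculus f \<xi> i \<in> Qp p" if i: "i \<in> X" for i
    unfolding Qp_iff
  proof
    fix n
    \<comment> \<open>Coherence relates two consecutive levels, so both must come from the same
      finite sum.\<close>
    obtain c N where "\<forall>i\<in>X. \<forall>m\<le>Suc n. calculus f \<xi> i m = lin c N \<xi> i m"
      using calculus_lin[OF f \<xi> d] by blast
    then have "calculus f \<xi> i n = lin c N \<xi> i n"
      and "calculus f \<xi> i (Suc n) = lin c N \<xi> i (Suc n)"
      using i by auto
    moreover have "lin c N \<xi> i \<in> Qp p" using QpX_Qp[OF lin_QpX[OF \<xi>] i] .
    ultimately show "plike p (calculus f \<xi> i n) \<and> 0 \<le> calculus f \<xi> i n \<and>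
        calculus f \<xi> i n < of_nat p ^ n \<and> calculus f \<xi> i n = rmod p n (calculus f \<xi> i (Suc n))"
      using Qp_plike Qp_bounds Qp_step by metis
  qed
  obtain c N where "\<forall>i\<in>X. \<forall>m\<le>0. calculus f \<xi> i m = lin c N \<xi> i m"
    using calculus_lin[OF f \<xi> d] by blast
  then have "{i\<in>X. calculus f \<xi> i 0 \<noteq> 0} = {i\<in>X. lin c N \<xi> i 0 \<noteq> 0}" by auto
  then show "finite {i\<in>X. calculus f \<xi> i 0 \<noteq> 0}" using QpX_finite[OF lin_QpX[OF \<xi>]] by simp
qed

lemma denom_le_lin:
  assumes \<xi>: "\<xi> \<in> QpX p X" and d: "denom_le d \<xi>"
  shows "denom_le d (lin c N \<xi>)"
proof (rule denom_le_pcong)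
  show "denom_le d (\<lambda>i m. \<Sum>n<N. of_int (c n) * B n \<xi> i m)"
    unfolding denom_le_def
  proof
    fix i assume i: "i \<in> X"
    have "\<forall>n. \<exists>t. B n \<xi> i 0 * of_nat p ^ d = of_int t"
      using B.denom_le_op[OF \<xi> d] i unfolding denom_le_def by blast
    then obtain t where "\<And>n. B n \<xi> i 0 * of_nat p ^ d = of_int (t n)" by metis
    then have "(\<Sum>n<N. of_int (c n) * B n \<xi> i 0) * of_nat p ^ d = of_int (\<Sum>n<N. c n * t n)"
      by (simp add: sum_distrib_right mult.assoc)
    then show "\<exists>t. (\<Sum>n<N. of_int (c n) * B n \<xi> i 0) * of_nat p ^ d = of_int t" by blast
  qed
qed (rule lin_pcong)

lemma denom_le_calculus:
  assumes f: "unif_cont f" and \<xi>: "\<xi> \<in> QpX p X" and d: "denom_le d \<xi>"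
  shows "denom_le d (calculus f \<xi>)"
proof -
  obtain c N where "\<forall>i\<in>X. \<forall>m\<le>0. calculus f \<xi> i m = lin c N \<xi> i m"
    using calculus_lin[OF f \<xi> d] by blast
  then show ?thesis using denom_le_lin[OF \<xi> d, of c N] unfolding denom_le_def by simp
qed

section \<open>Algebraic laws of the calculus\<close>

lemma calculus_vadd:
  assumes f: "unif_cont f" and \<xi>: "\<xi> \<in> QpX p X" and \<eta>: "\<eta> \<in> QpX p X"
  shows "calculus f (vadd p X \<xi> \<eta>) = vadd p X (calculus f \<xi>) (calculus f \<eta>)"
proof (intro QpX_eqI calculus_QpX vadd_QpX f \<xi> \<eta>)
  fix i m assume i: "i \<in> X"
  obtain d1 d2 where "denom_le d1 \<xi>" "denom_le d2 \<eta>" using denom_le_ex \<xi> \<eta> by meson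
  then obtain d where d: "denom_le d \<xi>" "denom_le d \<eta>"
    using denom_le_mono by (meson max.cobounded1 max.cobounded2)
  obtain g N where g: "approx f (m + d) g" and N: "\<And>n. n \<ge> N \<Longrightarrow> int p ^ (m + d) dvd mahler g n"
    using approx_ex[OF f] by blast
  note eq = calculus_eq_lin[OF f _ _ order_refl g N i]
  have "pcong p m (calculus f (vadd p X \<xi> \<eta>) i m) (\<Sum>n<N. of_int (mahler g n) * B n (vadd p X \<xi> \<eta>) i m)"
    using eq[OF vadd_QpX[OF \<xi> \<eta>] denom_le_vadd[OF d]] lin_pcong[OF i] by simp
  also have "pcong p m \<dots> (\<Sum>n<N. of_int (mahler g n) * (B n \<xi> i m + B n \<eta> i m))"
    unfolding Bops_vadd[OF B_Bops \<xi> \<eta>] vadd_apply[OF i] by (intro pcong_sum pcong_mult pcong_rmod)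
  also have "\<dots> = (\<Sum>n<N. of_int (mahler g n) * B n \<xi> i m) + (\<Sum>n<N. of_int (mahler g n) * B n \<eta> i m)"
    by (simp add: distrib_left sum.distrib)
  also have "pcong p m \<dots> (calculus f \<xi> i m + calculus f \<eta> i m)"
    using eq[OF \<xi> d(1)] eq[OF \<eta> d(2)] lin_pcong[OF i] by (simp add: pcong_add pcong_sym)
  also have "pcong p m \<dots> (vadd p X (calculus f \<xi>) (calculus f \<eta>) i m)"
    unfolding vadd_apply[OF i] by (rule pcong_sym[OF pcong_rmod])
  finally show "pcong p m (calculus f (vadd p X \<xi> \<eta>) i m) (vadd p X (calculus f \<xi>) (calculus f \<eta>) i m)" .
qed

lemma calculus_cadd:
  assumes f: "unif_cont f" "unif_cont f'" and \<xi>: "\<xi> \<in> QpX p X"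
  shows "calculus (cadd p f f') \<xi> = vadd p X (calculus f \<xi>) (calculus f' \<xi>)"
proof (intro QpX_eqI calculus_QpX vadd_QpX unif_cont_cadd f \<xi>)
  fix i m assume i: "i \<in> X"
  obtain d where d: "denom_le d \<xi>" using denom_le_ex[OF \<xi>] by blast
  obtain g N where g: "approx f (m + d) g" and N: "\<And>n. n \<ge> N \<Longrightarrow> int p ^ (m + d) dvd mahler g n"
    using approx_ex[OF f(1)] by blast
  obtain g' N' where g': "approx f' (m + d) g'" and N': "\<And>n. n \<ge> N' \<Longrightarrow> int p ^ (m + d) dvd mahler g' n"
    using approx_ex[OF f(2)] by blast
  let ?s = "\<lambda>k. g k + g' k" and ?M = "max N N'"
  have "int p ^ (m + d) dvd mahler ?s n" if "n \<ge> ?M" for n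
    using N N' that by (simp add: mahler_add)
  then have "calculus (cadd p f f') \<xi> i m = lin (mahler ?s) ?M \<xi> i m"
    by (intro calculus_eq_lin[OF unif_cont_cadd[OF f] \<xi> d order_refl approx_cadd[OF g g'] _ i])
  then have "pcong p m (calculus (cadd p f f') \<xi> i m) (\<Sum>n<?M. of_int (mahler ?s n) * B n \<xi> i m)"
    using lin_pcong[OF i] by simp
  also have "\<dots> = (\<Sum>n<?M. of_int (mahler g n) * B n \<xi> i m) + (\<Sum>n<?M. of_int (mahler g' n) * B n \<xi> i m)"
    by (simp add: mahler_add distrib_right sum.distrib)
  also have "pcong p m \<dots> (calculus f \<xi> i m + calculus f' \<xi> i m)"
  proof (rule pcong_add)
    have "calculus f \<xi> i m = lin (mahler g) ?M \<xi> i m"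
      using N by (intro calculus_eq_lin[OF f(1) \<xi> d order_refl g _ i]) simp
    then show "pcong p m (\<Sum>n<?M. of_int (mahler g n) * B n \<xi> i m) (calculus f \<xi> i m)"
      using pcong_sym[OF lin_pcong[OF i]] by simp
    have "calculus f' \<xi> i m = lin (mahler g') ?M \<xi> i m"
      using N' by (intro calculus_eq_lin[OF f(2) \<xi> d order_refl g' _ i]) simp
    then show "pcong p m (\<Sum>n<?M. of_int (mahler g' n) * B n \<xi> i m) (calculus f' \<xi> i m)"
      using pcong_sym[OF lin_pcong[OF i]] by simp
  qed
  also have "pcong p m \<dots> (vadd p X (calculus f \<xi>) (calculus f' \<xi>) i m)"
    unfolding vadd_apply[OF i] by (rule pcong_sym[OF pcong_rmod])
  finally show "pcong p m (calculus (cadd p f f') \<xi> i m) (vadd p X (calculus f \<xi>) (calculus f' \<xi>) i m)" .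
qed

text \<open>Truncated Newton series still represent both functions modulo p^(m + d), and their
  product has zero coefficients from N' + N on, so \<open>lin_mtrunc_mult\<close> applies. The outer
  evaluation may keep the same d because the inner one does not enlarge denominators.\<close>

lemma calculus_cmul:
  assumes f: "unif_cont f" "unif_cont f'" and \<xi>: "\<xi> \<in> QpX p X"
  shows "calculus (cmul p f f') \<xi> = calculus f (calculus f' \<xi>)"
proof (intro QpX_eqI calculus_QpX unif_cont_cmul f \<xi>)
  fix i m assume i: "i \<in> X"
  obtain d where d: "denom_le d \<xi>" using denom_le_ex[OF \<xi>] by blast
  obtain g N where g: "approx f (m + d) g" and N: "\<And>n. n \<ge> N \<Longrightarrow> int p ^ (m + d) dvd mahler g n"
    using approx_ex[OF f(1)] by blast
  obtain g' N' where g': "approx f' (m + d) g'" and N': "\<And>n. n \<ge> N' \<Longrightarrow> int p ^ (m + d) dvd mahler g' n"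
    using approx_ex[OF f(2)] by blast
  let ?h = "mtrunc N g" and ?h' = "mtrunc N' g'"
  have h: "approx f (m + d) ?h" by (rule approx_cong[OF g]) (rule dvd_mtrunc, rule N)
  have h': "approx f' (m + d) ?h'" by (rule approx_cong[OF g']) (rule dvd_mtrunc, rule N')
  have z: "mahler ?h' n = 0" if "n \<ge> N'" for n using that by (simp add: mahler_mtrunc)
  let ?u = "lin (mahler ?h') N' \<xi>"
  have "calculus (cmul p f f') \<xi> i m = lin (mahler (\<lambda>x. ?h x * ?h' x)) (N' + N) \<xi> i m"
    using lin_mtrunc_mult(1)[OF \<xi> z]
    by (intro calculus_eq_lin[OF unif_cont_cmul[OF f] \<xi> d order_refl approx_cmul[OF f h h'] _ i]) simp
  also have "\<dots> = lin (mahler g) N ?u i m"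
    by (simp only: lin_mtrunc_mult(2)[OF \<xi> z])
  also have "\<dots> = lin (mahler g) N (calculus f' \<xi>) i m"
  proof -
    have "calculus f' \<xi> j m = ?u j m" if "j \<in> X" for j
      using z by (intro calculus_eq_lin[OF f(2) \<xi> d order_refl h' _ that]) simp
    \<comment> \<open>The two inner vectors are only known to agree modulo p^m, but in every
      coordinate, which is what \<open>level_op\<close> requires.\<close>
    then have "B n ?u i m = B n (calculus f' \<xi>) i m" for n
      by (intro B.level_op lin_QpX calculus_QpX f \<xi> i) simp
    then show ?thesis by (simp add: lin_apply i)
  qed
  also have "\<dots> = calculus f (calculus f' \<xi>) i m"
    by (rule calculus_eq_lin[OF f(1) calculus_QpX[OF f(2) \<xi>] denom_le_calculus[OF f(2) \<xi> d] order_refl g N i, symmetric])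
  finally show "pcong p m (calculus (cmul p f f') \<xi> i m) (calculus f (calculus f' \<xi>) i m)" by simp
qed

lemma vscal_1: "\<xi> \<in> QpX p X \<Longrightarrow> vscal p X (qint p 1) \<xi> = \<xi>"
  by (intro QpX_eqI vscal_QpX) (simp_all add: vscal_apply)

lemma B_0: "\<xi> \<in> QpX p X \<Longrightarrow> B 0 \<xi> = \<xi>"
  using B_fact[of \<xi> 0] vscal_1[OF B_QpX, of \<xi> 0] by simp

lemma B_1: assumes \<xi>: "\<xi> \<in> QpX p X" shows "B 1 \<xi> = A \<xi>"
proof -
  have "B 1 \<xi> = vsub p X (A \<xi>) vzero"
    using B_fact[OF \<xi>, of 1] vscal_1[OF B_QpX[OF \<xi>], of 1] vscal_vzero[OF \<xi>] by simp
  also have "\<dots> = A \<xi>"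
    by (intro QpX_eqI vsub_QpX A_QpX vzero_QpX \<xi>) (simp add: vsub_apply vzero_def qzero_def)
  finally show ?thesis .
qed

text \<open>A constant has only the Mahler coefficient of index 0, and B 0 is the identity.
  \<open>vscal_QpX\<close> covers integer scalars only, so the residues are compared directly,
  without assuming that the right side lies in Q_p(X).\<close>

lemma calculus_cconst:
  assumes c: "c \<in> Zp p" and \<xi>: "\<xi> \<in> QpX p X"
  shows "calculus (cconst c) \<xi> = vscal p X c \<xi>"
proof (rule extensionalityI[of _ X])
  fix i assume i: "i \<in> X"
  show "calculus (cconst c) \<xi> i = vscal p X c \<xi> i"
  proof
    fix m
    obtain d where d: "denom_le d \<xi>" using denom_le_ex[OF \<xi>] by blast
    obtain t where t: "\<xi> i 0 * of_nat p ^ d = of_int t" using d i unfolding denom_le_def by blast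
    obtain a where a: "c (m + d) = of_int a" using Zp_int[OF c] by blast
    have "calculus (cconst c) \<xi> i m = lin (mahler (\<lambda>_. a)) 1 \<xi> i m"
      by (rule calculus_eq_lin[OF unif_cont_cconst[OF c] \<xi> d order_refl _ _ i])
        (simp_all add: approx_cconst a mahler_const)
    also have "\<dots> = rmod p m (of_int a * \<xi> i m)"
      by (simp add: lin_apply i mahler_const B_0[OF \<xi>])
    also have "\<dots> = vscal p X c \<xi> i m"
      using qmul_apply[OF c QpX_Qp[OF \<xi> i] t order_refl, of m a] i by (simp add: a vscal_def)
    finally show "calculus (cconst c) \<xi> i m = vscal p X c \<xi> i m" .
  qed
qed (simp_all add: calculus_def vscal_def)

lemma calculus_cone: "\<xi> \<in> QpX p X \<Longrightarrow> calculus (cone p) \<xi> = \<xi>"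
  using calculus_cconst[OF qint_Zp, of \<xi> 1] vscal_1 by (simp add: cone_def qone_def cconst_def)

lemma calculus_cid:
  assumes \<xi>: "\<xi> \<in> QpX p X"
  shows "calculus (cid p) \<xi> = A \<xi>"
proof (intro QpX_eqI calculus_QpX A_QpX unif_cont_cid \<xi>)
  fix i m assume i: "i \<in> X"
  obtain d where d: "denom_le d \<xi>" using denom_le_ex[OF \<xi>] by blast
  have c: "mahler int n = (if n = 1 then 1 else 0)" for n
    using mahler_binomial[of 1 n] by simp
  \<comment> \<open>The identity is (x choose 1), so cutoff 2 keeps its only nonzero
    coefficient.\<close>
  have "calculus (cid p) \<xi> i m = lin (mahler int) 2 \<xi> i m"
    by (rule calculus_eq_lin[OF unif_cont_cid \<xi> d order_refl approx_cid _ i]) (simp add: c)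
  also have "\<dots> = rmod p m (B 1 \<xi> i m)"
    by (simp add: lin_apply i c numeral_2_eq_2)
  finally show "pcong p m (calculus (cid p) \<xi> i m) (A \<xi> i m)"
    unfolding B_1[OF \<xi>] by simp
qed

lemma calculus_cscal:
  assumes c: "c \<in> Zp p" and f: "unif_cont f" and \<xi>: "\<xi> \<in> QpX p X"
  shows "calculus (cscal p c f) \<xi> = vscal p X c (calculus f \<xi>)"
proof -
  have "cscal p c f = cmul p (cconst c) f"
    unfolding cscal_def cmul_def cconst_def by auto
  then show ?thesis
    using calculus_cmul[OF unif_cont_cconst[OF c] f \<xi>] calculus_cconst[OF c calculus_QpX[OF f \<xi>]] by simp
qed

text \<open>Scaling is the calculus of a constant function, and products of functions commute;
  multiplicativity moves the scalar across.\<close>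

lemma calculus_vscal:
  assumes c: "c \<in> Zp p" and f: "unif_cont f" and \<xi>: "\<xi> \<in> QpX p X"
  shows "calculus f (vscal p X c \<xi>) = vscal p X c (calculus f \<xi>)"
proof -
  have "calculus f (vscal p X c \<xi>) = calculus (cmul p f (cconst c)) \<xi>"
    using calculus_cmul[OF f unif_cont_cconst[OF c] \<xi>] calculus_cconst[OF c \<xi>] by simp
  also have "cmul p f (cconst c) = cmul p (cconst c) f"
    unfolding cmul_def by (simp add: qmul_commute)
  finally show ?thesis
    using calculus_cmul[OF unif_cont_cconst[OF c] f \<xi>] calculus_cconst[OF c calculus_QpX[OF f \<xi>]] by simp
qed

section \<open>Continuity and contractivity of the calculus\<close>

lemma B_cont0_common:
  assumes F: "finite F" "F \<subseteq> X"
  shows "\<exists>F' m'. finite F' \<and> F' \<subseteq> X \<and> (\<forall>\<xi> \<in> nbh F' m'. \<forall>n<N. B n \<xi> \<in> nbh F m)"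
proof (induction N)
  case 0
  show ?case by (intro exI[of _ "{}"]) simp
next
  case (Suc N)
  then obtain F1 m1 where 1: "finite F1" "F1 \<subseteq> X" "\<forall>\<xi> \<in> nbh F1 m1. \<forall>n<N. B n \<xi> \<in> nbh F m" by blast
  obtain F2 m2 where 2: "finite F2" "F2 \<subseteq> X" "\<forall>\<xi> \<in> nbh F2 m2. B N \<xi> \<in> nbh F m"
    using Bops_cont0[OF B_Bops[of N]] F unfolding cont0_def by meson
  have "\<xi> \<in> nbh F1 m1" "\<xi> \<in> nbh F2 m2" if \<xi>: "\<xi> \<in> nbh (F1 \<union> F2) (max m1 m2)" for \<xi>
  proof -
    have V: "\<xi> \<in> QpX p X" using \<xi> unfolding nbh_def by blast
    have "\<xi> i k = 0" if "i \<in> F1 \<union> F2" "k \<le> max m1 m2" for i k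
      using Qp_zero_mono[OF QpX_Qp[OF V], of i "max m1 m2" k] \<xi> that 1(2) 2(2) unfolding nbh_def by blast
    then show "\<xi> \<in> nbh F1 m1" "\<xi> \<in> nbh F2 m2" using \<xi> unfolding nbh_def by auto
  qed
  then have "\<forall>\<xi> \<in> nbh (F1 \<union> F2) (max m1 m2). \<forall>n<Suc N. B n \<xi> \<in> nbh F m"
    using 1(3) 2(3) less_Suc_eq by metis
  then show ?case using 1 2 by (metis Un_least finite_UnI)
qed

lemma calculus_integral:
  assumes f: "unif_cont f" and \<xi>: "\<xi> \<in> QpX p X" "\<forall>i\<in>X. \<xi> i 0 = 0" and i: "i \<in> X"
  shows "calculus f \<xi> i 0 = 0"
proof -
  have "denom_le 0 (calculus f \<xi>)"
    using \<xi> by (intro denom_le_calculus f) (auto simp: denom_le_def intro: exI[of _ 0])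
  then show ?thesis
    using Qp_int_iff[OF QpX_Qp[OF calculus_QpX[OF f \<xi>(1)] i], of 0] i unfolding denom_le_def by simp
qed

text \<open>On the unit ball d = 0, so coefficients modulo p^m suffice and the cutoff
  \<open>N\<close> is the same for all vectors. One neighbourhood for finitely many
  \<open>B n\<close> is then enough.\<close>

lemma calculus_cont0:
  assumes f: "unif_cont f"
  shows "cont0 (calculus f)"
  unfolding cont0_def
proof (intro allI impI)
  fix F m assume F: "finite F \<and> F \<subseteq> X"
  obtain N where N: "\<forall>n\<ge>N. int p ^ m dvd mahler (residues f m) n"
    using mahler_eventually[OF f approx_residues[OF f]] by blast
  obtain F' m' where F': "finite F'" "F' \<subseteq> X" and B: "\<forall>\<xi> \<in> nbh F' m'. \<forall>n<N. B n \<xi> \<in> nbh F m"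
    using B_cont0_common F by meson
  have "calculus f \<xi> \<in> nbh F m" if \<xi>: "\<xi> \<in> nbh F' m'" for \<xi>
  proof -
    have V: "\<xi> \<in> QpX p X" and 0: "\<forall>i\<in>X. \<xi> i 0 = 0" using \<xi> unfolding nbh_def by auto
    have d: "denom_le 0 \<xi>" using 0 by (auto simp: denom_le_def intro: exI[of _ 0])
    have "calculus f \<xi> i m = 0" if i: "i \<in> F" for i
    proof -
      have iX: "i \<in> X" using i F by blast
      have "calculus f \<xi> i m = lin (mahler (residues f m)) N \<xi> i m"
        using N by (intro calculus_eq_lin[OF f V d _ approx_residues[OF f] _ iX]) auto
      then show ?thesis using B \<xi> i by (simp add: lin_apply iX nbh_def)
    qed
    then show ?thesis using calculus_integral[OF f V 0] calculus_QpX[OF f V] unfolding nbh_def by blast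
  qed
  then show "\<exists>F' m'. finite F' \<and> F' \<subseteq> X \<and> (\<forall>\<xi> \<in> nbh F' m'. calculus f \<xi> \<in> nbh F m)"
    using F' by blast
qed

lemma calculus_Bops:
  assumes f: "unif_cont f"
  shows "calculus f \<in> Bops p X"
  unfolding Bops_def Zp_linear_def
  using calculus_QpX[OF f] calculus_vadd[OF f] calculus_vscal[OF _ f]
    cont0_tau_continuous[OF _ _ calculus_cont0[OF f]] by blast

text \<open>If an entry had norm p^(-k) above the supremum norm, discreteness of the norm would make
  all values of \<open>f\<close> vanish modulo p^(k + 1), and so would the entry, a
  contradiction.\<close>

lemma opnorm_calculus:
  assumes f: "unif_cont f"
  shows "opnorm p X (calculus f) \<le> supnorm p f"
proof -
  let ?s = "supnorm p f"
  have bdd: "bdd_above ((\<lambda>z. qnorm p (f z)) ` Zp p)"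
    using Zp_le_1 unif_cont_Zp[OF f] by (auto intro!: bdd_aboveI2)
  have s: "qnorm p (f z) \<le> ?s" if "z \<in> Zp p" for z
    unfolding supnorm_def using bdd that by (intro cSup_upper) auto
  have s0: "?s \<ge> 0" using s[OF qint_Zp[of 0]] qnorm_ge_0[of "f (qint p 0)"] by linarith
  have "vnorm p X (calculus f \<xi>) \<le> ?s" if \<xi>: "\<xi> \<in> QpX p X" "vnorm p X \<xi> \<le> 1" for \<xi>
  proof (rule vnorm_le[OF s0])
    fix i assume i: "i \<in> X"
    have 0: "\<forall>i\<in>X. \<xi> i 0 = 0" using \<xi> vnorm_le_1_iff by blast
    have d: "denom_le 0 \<xi>" using 0 by (auto simp: denom_le_def intro: exI[of _ 0])
    let ?x = "calculus f \<xi> i"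
    have x: "?x \<in> Zp p"
      using QpX_Qp[OF calculus_QpX[OF f \<xi>(1)] i] calculus_integral[OF f \<xi>(1) 0 i] by (simp add: Zp_def)
    show "qnorm p ?x \<le> ?s"
    proof (rule ccontr)
      assume "\<not> qnorm p ?x \<le> ?s"
      then have less: "?s < qnorm p ?x" by simp
      then have "?x \<noteq> qzero" using s0 by (auto simp: qnorm_def)
      then obtain k where k: "qnorm p ?x = inverse (real p ^ k)" "?x (Suc k) \<noteq> 0"
        using Zp_qnorm[OF x] by blast
      have "f z (Suc k) = 0" if "z \<in> Zp p" for z
        using qnorm_less[OF Zp_Qp[OF unif_cont_Zp[OF f that]], of k] s[OF that] less k(1) by linarith
      \<comment> \<open>The zero sequence represents \<open>f\<close> at this level, so the empty
        sum computes the entry.\<close>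
      then have "approx f (Suc k) (\<lambda>_. 0)" by (simp add: approx_def)
      then have "?x (Suc k) = lin (mahler (\<lambda>_. 0)) 0 \<xi> i (Suc k)"
        by (intro calculus_eq_lin[OF f \<xi>(1) d _ _ _ i]) (auto simp: mahler_const)
      then show False using k(2) by (simp add: lin_apply i)
    qed
  qed
  then show ?thesis unfolding opnorm_def using s0 by (intro cSup_least) auto
qed

end

theorem theorem2p21:
  fixes p :: nat and X :: "'a set" and A :: "'a qvec \<Rightarrow> 'a qvec"
  assumes "prime p"
    and "countable X"
    and "A \<in> Bops p X"
    and "normal_contraction p X A"
  shows "\<exists>\<pi> :: (qp \<Rightarrow> qp) \<Rightarrow> ('a qvec \<Rightarrow> 'a qvec).
           (\<forall>f \<in> CZ p. \<pi> f \<in> Bops p X)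
         \<and> (\<forall>f \<in> CZ p. \<forall>g \<in> CZ p. \<forall>\<xi> \<in> QpX p X.
               \<pi> (cadd p f g) \<xi> = vadd p X (\<pi> f \<xi>) (\<pi> g \<xi>))
         \<and> (\<forall>f \<in> CZ p. \<forall>g \<in> CZ p. \<forall>\<xi> \<in> QpX p X.
               \<pi> (cmul p f g) \<xi> = \<pi> f (\<pi> g \<xi>))
         \<and> (\<forall>c \<in> Zp p. \<forall>f \<in> CZ p. \<forall>\<xi> \<in> QpX p X.
               \<pi> (cscal p c f) \<xi> = vscal p X c (\<pi> f \<xi>))
         \<and> (\<forall>\<xi> \<in> QpX p X. \<pi> (cone p) \<xi> = \<xi>)
         \<and> (\<forall>f \<in> CZ p. opnorm p X (\<pi> f) \<le> supnorm p f)
         \<and> (\<forall>\<xi> \<in> QpX p X. \<pi> (cid p) \<xi> = A \<xi>)"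
proof -
  obtain B where B: "\<forall>n. B n \<in> Bops p X \<and>
      (\<forall>\<xi> \<in> QpX p X. vscal p X (qint p (int (fact n))) (B n \<xi>) = falling_op p X A n \<xi>) \<and>
      opnorm p X (B n) \<le> 1"
    using assms(4) unfolding normal_contraction_def Bex_def by metis
  interpret normal_op p X A B
    using assms(1,3) B by unfold_locales auto
  show ?thesis
    by (intro exI[of _ calculus] conjI ballI calculus_Bops calculus_cadd calculus_cmul calculus_cscal
        calculus_cone opnorm_calculus calculus_cid CZ_unif_cont)
qed

end
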